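(* Let $\alpha\in(0,2)$ and assume the setting described in the context ($\xi$ in the domain of attraction of an $\alpha$-stable law $\mathcal S_\alpha$, with normalising and centering sequences $(a_n),(b_n)$), with $p>0$. Let $(x_n)$ be a real sequence. (1) If $\lim_{n\to\infty}\frac{x_n}{a_n}=\infty$, then as $n\to\infty$ $$\mathbb P(S_n-b_n\ge x_n)\sim\mathbb P(S_n-b_n\ge x_n,\ M_n\ge x_n)\sim\mathbb P(M_n\ge x_n).$$ (2) The condition $\lim_{n\to\infty}\frac{x_n}{a_n}=\infty$ is necessary and sufficient for $$\lim_{n\to\infty}d_{\mathrm{TV}}\Big(\mathscr L\big(R(\xi_1,\dots,\xi_n)\,\big|\,S_n-b_n\ge x_n\big),\ \mathscr L(\xi)^{\otimes(n-1)}\Big)=0 .$$ (3) In particular, if $\lim_{n\to\infty}\frac{x_n}{a_n}=\infty$, then $$\mathscr L\Big(\frac{S_n-b_n-M_n}{a_n}\ \Big|\ S_n-b_n\ge x_n\Big)\xrightarrow[n\to\infty]{w}\mathscr L(\mathcal S_\alpha),$$ where $\xrightarrow{w}$ denotes weak convergence.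
   Context: $\xi$ is a real random variable, $\xi_1,\xi_2,\dots$ are i.i.d. copies, $F(x)=\mathbb P(\xi\le x)$, $\overline F=1-F$, $S_n=\sum_{i=1}^n\xi_i$, $M_n=\max\{\xi_1,\dots,\xi_n\}$. There is a slowly varying function $L$ and $p,q\ge0$ with $p+q=1$ such that $\overline F(x)\sim pL(x)x^{-\alpha}$ and $F(-x)\sim qL(x)x^{-\alpha}$ as $x\to\infty$ (if $p=0$ or $q=0$ the corresponding relation is read as $o(L(x)x^{-\alpha})$). $(a_n)$ is a positive sequence, $a_n\to\infty$, with $L(a_n)a_n^{-\alpha}\sim n^{-1}$, and $b_n=0$ if $\alpha\in(0,1)$, $b_n=n\mathbb E[\xi\mathbf 1_{\{|\xi|\le a_n\}}]$ if $\alpha=1$, $b_n=n\mathbb E[\xi]$ if $\alpha\in(1,2)$. Then $(S_n-b_n)/a_n$ converges in distribution to an $\alpha$-stable random variable, denoted $\mathcal S_\alpha$. For $y=(y_1,\dots,y_n)\in\mathbb R^n$, $R(y)\in\mathbb R^{n-1}$ is obtained from $y$ by deleting the coordinate $y_i$ with $i=\min\{i:\ y_i=\max_{1\le j\le n}y_j\}$ (keeping the order of the others). $\mathscr L(X\mid A)$ is the law of $X$ conditioned on the event $A$; $d_{\mathrm{TV}}(P,Q)=\sup_A|P(A)-Q(A)|$. *)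

theory Defs
  imports "HOL-Probability.Probability" "HOL-Library.Landau_Symbols"
begin

definition slowly_varying :: "(real \<Rightarrow> real) \<Rightarrow> bool" where
  "slowly_varying L \<longleftrightarrow>
     (\<exists>A>0. (\<forall>x\<ge>A. L x > 0) \<and> set_borel_measurable borel {A..} L) \<and>
     (\<forall>c>0. ((\<lambda>x. L (c * x) / L x) \<longlongrightarrow> 1) at_top)"

text \<open>
  The relation f \<open>\<sim>\<close> c g at infinity, read as f = o(g) when c = 0. The case
  distinction is needed because \<open>f \<sim>[at_top] (\<lambda>_. 0)\<close> would say that f vanishes eventually.
\<close>
definition tail_equiv :: "real \<Rightarrow> (real \<Rightarrow> real) \<Rightarrow> (real \<Rightarrow> real) \<Rightarrow> bool" where
  "tail_equiv c f g \<longleftrightarrow>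
     (if c = 0 then f \<in> o[at_top](g) else f \<sim>[at_top] (\<lambda>x. c * g x))"

text \<open>
  A non-degenerate law such that the sum of n independent copies of Y has the law of
  \<open>n\<^sup>1\<^sup>/\<^sup>\<alpha> Y + d\<^sub>n\<close> for some real constant \<open>d\<^sub>n\<close>.
\<close>
definition alpha_stable :: "real \<Rightarrow> real measure \<Rightarrow> bool" where
  "alpha_stable \<alpha> \<mu> \<longleftrightarrow>
     real_distribution \<mu> \<and> (\<forall>c. \<mu> \<noteq> return borel c) \<and>
     (\<forall>n\<ge>1. \<exists>d. distr (Pi\<^sub>M {..<n} (\<lambda>_. \<mu>)) borel (\<lambda>y. \<Sum>i<n. y i) =
                 distr \<mu> borel (\<lambda>y. real n powr (1 / \<alpha>) * y + d))"

text \<open>Sequences of random variables are indexed from 0: the first n variables are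
  \<open>X 0, \<dots>, X (n - 1)\<close>. The value of \<open>partial_max\<close> at \<open>n = 0\<close> is meaningless.\<close>

definition partial_sum :: "(nat \<Rightarrow> 'a \<Rightarrow> real) \<Rightarrow> nat \<Rightarrow> 'a \<Rightarrow> real" where
  "partial_sum X n \<omega> = (\<Sum>i<n. X i \<omega>)"

definition partial_max :: "(nat \<Rightarrow> 'a \<Rightarrow> real) \<Rightarrow> nat \<Rightarrow> 'a \<Rightarrow> real" where
  "partial_max X n \<omega> = Max ((\<lambda>i. X i \<omega>) ` {..<n})"

definition centering ::
  "'a measure \<Rightarrow> ('a \<Rightarrow> real) \<Rightarrow> real \<Rightarrow> (nat \<Rightarrow> real) \<Rightarrow> nat \<Rightarrow> real" where
  "centering M \<xi> \<alpha> a n =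
     (if \<alpha> < 1 then 0
      else if \<alpha> = 1 then real n * (\<integral>\<omega>. \<xi> \<omega> * indicator {\<omega>. \<bar>\<xi> \<omega>\<bar> \<le> a n} \<omega> \<partial>M)
      else real n * (\<integral>\<omega>. \<xi> \<omega> \<partial>M))"

text \<open>
  A vector of \<open>\<real>\<^sup>n\<close> is a function on \<open>{..<n}\<close>, extended by \<open>undefined\<close> as in
  \<open>Pi\<^sub>M {..<n}\<close>. This deletes the first coordinate at which the maximum is attained.
\<close>
definition delete_max :: "nat \<Rightarrow> (nat \<Rightarrow> real) \<Rightarrow> (nat \<Rightarrow> real)" where
  "delete_max n y =
     (let k = (LEAST i. i < n \<and> y i = Max (y ` {..<n}))
      in (\<lambda>j\<in>{..<n - 1}. if j < k then y j else y (Suc j)))"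

text \<open>The law of X, as a measure on the measurable space N, conditioned on the event A
  (meaningful if A has positive probability).\<close>
definition cond_law :: "'a measure \<Rightarrow> 'a set \<Rightarrow> 'b measure \<Rightarrow> ('a \<Rightarrow> 'b) \<Rightarrow> 'b measure" where
  "cond_law M A N X = distr (uniform_measure M A) N X"

text \<open>Intended for probability measures P, Q with \<open>sets P = sets Q\<close>.\<close>
definition tv_dist :: "'a measure \<Rightarrow> 'a measure \<Rightarrow> real" where
  "tv_dist P Q = (SUP A\<in>sets P. \<bar>measure P A - measure Q A\<bar>)"

end

theory Submission imports Defs begin

text \<open>
  Let W and H be the right and the two-sided tail of the law of \<open>\<xi>\<close>; regular variation gives
  \<open>W / H \<rightarrow> p\<close>, \<open>H (c * t) / H t \<rightarrow> c powr (- \<alpha>)\<close> and \<open>n * H (a n) \<rightarrow> 1\<close>. Everything is compared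
  with \<open>w = n * W (x n)\<close>, which tends to 0. A large sum is caused by one big jump. Lower bound: by
  Bonferroni, with probability about w one summand exceeds \<open>(1 + e) * x n\<close> while the sum of the
  others, which is tight on the scale \<open>a n\<close>, moves by less than \<open>e * x n\<close>. Upper bound: either some
  summand exceeds \<open>(1 - e) * x n\<close>, or some summand exceeds \<open>e * x n\<close> and the others together also
  exceed \<open>e * x n\<close>, which is negligible, or all summands are below \<open>e * x n\<close>; for the last event
  Chebyshev's inequality for the truncated sum gives a bound of order \<open>e powr (2 - \<alpha>) * w\<close>.

  If the maximum is at least \<open>x n\<close>, a union bound over its position shows that the other
  coordinates fall into A with probability at most w times the product measure of A. Applied to A
  and to its complement this gives the convergence in total variation, and pushing forward under
  the sum gives the weak convergence. If \<open>x n / a n\<close> does not tend to infinity, the conditioning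
  event has probability bounded below along a subsequence, and conditioning on it leaves the
  coordinates other than the maximum with too few values of order \<open>a n\<close>.
\<close>


section \<open>Independent copies and the coordinates other than the maximum\<close>

text \<open>The order-preserving enumeration of the naturals other than \<open>i\<close>. It turns
  the removal of a coordinate into a reindexing along a bijection.\<close>

definition skip :: "nat \<Rightarrow> nat \<Rightarrow> nat" where
  "skip i j = (if j < i then j else Suc j)"

lemma inj_skip: "inj (skip i)"
  by (auto simp: skip_def inj_def split: if_splits)

lemma bij_betw_skip: "i < n \<Longrightarrow> bij_betw (skip i) {..<n - 1} ({..<n} - {i})"
proof (rule bij_betw_imageI)
  assume i: "i < n"
  show "skip i ` {..<n - 1} = {..<n} - {i}"
  proof safe
    fix j assume j: "j < n" "j \<notin> skip i ` {..<n - 1}"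
    show "j = i"
    proof (rule ccontr)
      assume "j \<noteq> i"
      then have "j = skip i (if j < i then j else j - 1)" "(if j < i then j else j - 1) < n - 1"
        using j i by (auto simp: skip_def)
      then show False using j by blast
    qed
  qed (use i in \<open>auto simp: skip_def split: if_splits\<close>)
qed (rule inj_on_subset[OF inj_skip], simp)

text \<open>In contrast to \<open>delete_max\<close> the removed index is fixed, so for independent
  coordinates the result is independent of the removed one.\<close>

definition drop_coord :: "nat \<Rightarrow> nat \<Rightarrow> (nat \<Rightarrow> real) \<Rightarrow> nat \<Rightarrow> real" where
  "drop_coord n i y = (\<lambda>j\<in>{..<n - 1}. y (skip i j))"

lemma sum_drop_coord:
  assumes "i < n"
  shows "(\<Sum>j<n - 1. drop_coord n i y j) = (\<Sum>j<n. y j) - y i"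
proof -
  have "(\<Sum>j<n - 1. drop_coord n i y j) = (\<Sum>j<n - 1. y (skip i j))"
    by (simp add: drop_coord_def)
  also have "\<dots> = (\<Sum>j\<in>{..<n} - {i}. y j)"
    by (rule sum.reindex_bij_betw[OF bij_betw_skip[OF assms]])
  also have "\<dots> = (\<Sum>j<n. y j) - y i"
    using assms by (subst sum_diff1) auto
  finally show ?thesis .
qed

text \<open>Reduces the random deletion to a fixed one, so that union bounds can run over
  \<open>k\<close>. Which maximiser is deleted in case of a tie is forgotten here.\<close>

lemma delete_max_argmax:
  assumes "n \<ge> 1"
  obtains k where "k < n" "y k = Max (y ` {..<n})" "delete_max n y = drop_coord n k y"
proof -
  have "Max (y ` {..<n}) \<in> y ` {..<n}" using assms by (intro Max_in) (auto simp: lessThan_empty_iff)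
  then have ex: "\<exists>i. i < n \<and> y i = Max (y ` {..<n})" by (metis imageE lessThan_iff)
  define k where "k = (LEAST i. i < n \<and> y i = Max (y ` {..<n}))"
  have "k < n \<and> y k = Max (y ` {..<n})" unfolding k_def by (rule LeastI_ex[OF ex])
  moreover have "delete_max n y = drop_coord n k y"
    by (auto simp: delete_max_def Let_def drop_coord_def skip_def k_def[symmetric])
  ultimately show ?thesis using that by blast
qed

section \<open>I.i.d. sequences: measurability, and independence of one coordinate from the
  rest\<close>

locale iid_sequence = prob_space M for M :: "'a measure" +
  fixes X :: "nat \<Rightarrow> 'a \<Rightarrow> real" and D :: "real measure"
  assumes indep: "indep_vars (\<lambda>_. borel) X UNIV"
    and law: "distr M borel (X i) = D"
begin

lemma X_measurable [measurable]: "X i \<in> borel_measurable M"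
  using indep by (auto simp: indep_vars_def)

sublocale D: real_distribution D
  using real_distribution_distr[OF X_measurable[of 0]] by (simp add: law)

lemma prob_X:
  assumes "B \<in> sets borel"
  shows "prob {\<omega> \<in> space M. X i \<omega> \<in> B} = measure D B"
proof -
  have "measure D B = measure (distr M borel (X i)) B" by (simp add: law)
  also have "\<dots> = prob {\<omega> \<in> space M. X i \<omega> \<in> B}"
    using assms by (subst measure_distr) (auto intro!: arg_cong[where f=prob])
  finally show ?thesis by simp
qed

lemma prob_pair:
  assumes "i \<noteq> j" "B \<in> sets borel" "C \<in> sets borel"
  shows "prob {\<omega> \<in> space M. X i \<omega> \<in> B \<and> X j \<omega> \<in> C} = measure D B * measure D C"
proof -
  have "prob (\<Inter>k\<in>{i,j}. X k -` (if k = i then B else C) \<inter> space M)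
      = (\<Prod>k\<in>{i,j}. prob (X k -` (if k = i then B else C) \<inter> space M))"
    using assms by (intro indep_varsD[OF indep]) auto
  moreover have "(\<Inter>k\<in>{i,j}. X k -` (if k = i then B else C) \<inter> space M)
      = {\<omega> \<in> space M. X i \<omega> \<in> B \<and> X j \<omega> \<in> C}" using assms by auto
  moreover have "X k -` B' \<inter> space M = {\<omega> \<in> space M. X k \<omega> \<in> B'}" for k B' by auto
  ultimately show ?thesis using assms by (simp add: prob_X)
qed

lemma drop_coord_measurable [measurable]:
  "(\<lambda>\<omega>. drop_coord n i (\<lambda>j. X j \<omega>)) \<in> measurable M (Pi\<^sub>M {..<n - 1} (\<lambda>_. borel))"
  unfolding drop_coord_def by (intro measurable_restrict) auto

lemma delete_max_measurable [measurable]: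
  "(\<lambda>\<omega>. delete_max n (\<lambda>j. X j \<omega>)) \<in> measurable M (Pi\<^sub>M {..<n - 1} (\<lambda>_. borel))"
proof -
  have [measurable]: "(\<lambda>\<omega>. Max ((\<lambda>i. X i \<omega>) ` {..<n})) \<in> borel_measurable M"
    by (rule borel_measurable_Max) auto
  \<comment> \<open>The deleted index is a measurable function with discrete values, so the case
    distinction on it in \<open>delete_max\<close> is measurable.\<close>
  have [measurable]: "(\<lambda>\<omega>. LEAST i. i < n \<and> X i \<omega> = Max ((\<lambda>i. X i \<omega>) ` {..<n})) \<in> measurable M (count_space UNIV)"
    by measurable
  show ?thesis
    unfolding delete_max_def Let_def
    by (intro measurable_restrict) measurable
qed

lemma partial_sum_measurable [measurable]: "partial_sum X n \<in> borel_measurable M"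
  unfolding partial_sum_def[abs_def] by measurable

lemma partial_max_measurable [measurable]: "partial_max X n \<in> borel_measurable M"
  unfolding partial_max_def[abs_def] by (rule borel_measurable_Max) auto

text \<open>The restrictions of the sequence to the disjoint index sets \<open>{i}\<close> and
  \<open>{..<n} - {i}\<close> are independent, and \<open>drop_coord\<close> is a measurable
  reindexing \<open>f\<close> of the second one.\<close>

lemma prob_coord_and_rest:
  assumes i: "i < n" and n: "n \<ge> 2" and B: "B \<in> sets borel"
    and A: "A \<in> sets (Pi\<^sub>M {..<n - 1} (\<lambda>_. borel))"
  shows "prob {\<omega> \<in> space M. X i \<omega> \<in> B \<and> drop_coord n i (\<lambda>j. X j \<omega>) \<in> A}
       = measure D B * prob {\<omega> \<in> space M. drop_coord n i (\<lambda>j. X j \<omega>) \<in> A}"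
proof -
  let ?J = "{..<n} - {i}"
  define f where "f y = (\<lambda>j\<in>{..<n - 1}. y (skip i j))" for y :: "nat \<Rightarrow> real"
  have fm: "f \<in> measurable (Pi\<^sub>M ?J (\<lambda>_. borel)) (Pi\<^sub>M {..<n - 1} (\<lambda>_. borel))"
    unfolding f_def using bij_betw_skip[OF i]
    by (intro measurable_restrict measurable_component_singleton) (auto simp: bij_betw_def)
  have iv: "indep_var (PiM {i} (\<lambda>_. borel :: real measure)) (\<lambda>\<omega>. restrict (\<lambda>j. X j \<omega>) {i})
          (PiM ?J (\<lambda>_. borel)) (\<lambda>\<omega>. restrict (\<lambda>j. X j \<omega>) ?J)"
    by (rule indep_var_restrict[OF indep]) auto
  let ?B = "{y \<in> space (PiM {i} (\<lambda>_. borel :: real measure)). y i \<in> B}"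
  let ?A = "f -` A \<inter> space (Pi\<^sub>M ?J (\<lambda>_. borel))"
  have f: "f (restrict (\<lambda>j. X j \<omega>) ?J) = drop_coord n i (\<lambda>j. X j \<omega>)" for \<omega>
    using bij_betw_skip[OF i] by (auto simp: fun_eq_iff f_def drop_coord_def bij_betw_def restrict_def)
  have memB: "restrict (\<lambda>j. X j \<omega>) {i} \<in> ?B \<longleftrightarrow> X i \<omega> \<in> B" for \<omega>
    by (simp add: space_PiM)
  have memA: "restrict (\<lambda>j. X j \<omega>) ?J \<in> ?A \<longleftrightarrow> drop_coord n i (\<lambda>j. X j \<omega>) \<in> A" for \<omega>
    unfolding vimage_eq Int_iff f by (simp add: space_PiM)
  have "?B \<in> sets (PiM {i} (\<lambda>_. borel))" using B by measurable
  moreover have "?A \<in> sets (Pi\<^sub>M ?J (\<lambda>_. borel))" using measurable_sets[OF fm A] .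
  ultimately have "prob ((\<lambda>\<omega>. (restrict (\<lambda>j. X j \<omega>) {i}, restrict (\<lambda>j. X j \<omega>) ?J)) -` (?B \<times> ?A) \<inter> space M)
      = prob ((\<lambda>\<omega>. restrict (\<lambda>j. X j \<omega>) {i}) -` ?B \<inter> space M) *
        prob ((\<lambda>\<omega>. restrict (\<lambda>j. X j \<omega>) ?J) -` ?A \<inter> space M)"
    by (rule indep_varD[OF iv])
  moreover have "(\<lambda>\<omega>. (restrict (\<lambda>j. X j \<omega>) {i}, restrict (\<lambda>j. X j \<omega>) ?J)) -` (?B \<times> ?A) \<inter> space M
      = {\<omega> \<in> space M. X i \<omega> \<in> B \<and> drop_coord n i (\<lambda>j. X j \<omega>) \<in> A}"
    unfolding vimage_def[where B = "?B \<times> ?A"] mem_Times_iff fst_conv snd_conv memA memB by blast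
  moreover have "(\<lambda>\<omega>. restrict (\<lambda>j. X j \<omega>) {i}) -` ?B \<inter> space M = {\<omega> \<in> space M. X i \<omega> \<in> B}"
    unfolding vimage_def[where B = ?B] memB by blast
  moreover have "(\<lambda>\<omega>. restrict (\<lambda>j. X j \<omega>) ?J) -` ?A \<inter> space M
      = {\<omega> \<in> space M. drop_coord n i (\<lambda>j. X j \<omega>) \<in> A}"
    unfolding vimage_def[where B = ?A] memA by blast
  ultimately show ?thesis by (simp only: prob_X[OF B])
qed

lemma law_rest:
  assumes i: "i < n" and n: "n \<ge> 2"
  shows "distr M (Pi\<^sub>M {..<n - 1} (\<lambda>_. borel)) (\<lambda>\<omega>. drop_coord n i (\<lambda>j. X j \<omega>))
       = Pi\<^sub>M {..<n - 1} (\<lambda>_. D)"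
proof -
  \<comment> \<open>Independence is transported along \<open>skip i\<close> by grouping into the
    singleton blocks \<open>{skip i j}\<close>, which are disjoint by injectivity.\<close>
  have "indep_vars (\<lambda>j. PiM {skip i j} (\<lambda>_. borel :: real measure))
      (\<lambda>j \<omega>. restrict (\<lambda>k. X k \<omega>) {skip i j}) {..<n - 1}"
    using inj_skip[of i] by (intro indep_vars_restrict[OF indep]) (auto simp: disjoint_family_on_def inj_def)
  then have "indep_vars (\<lambda>_. borel) (\<lambda>j \<omega>. (\<lambda>y. y (skip i j)) (restrict (\<lambda>k. X k \<omega>) {skip i j})) {..<n - 1}"
    by (rule indep_vars_compose2) auto
  then have "indep_vars (\<lambda>_. borel) (\<lambda>j. X (skip i j)) {..<n - 1}"
    by simp
  then show ?thesis
    \<comment> \<open>\<open>n \<ge> 2\<close> makes the index set nonempty, as the characterisation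
      of independence by the product law requires.\<close>
    using n unfolding drop_coord_def
    by (subst (asm) indep_vars_iff_distr_eq_PiM) (auto simp: lessThan_empty_iff law)
qed

lemma prob_rest:
  assumes "i < n" "n \<ge> 2" and A: "A \<in> sets (Pi\<^sub>M {..<n - 1} (\<lambda>_. borel))"
  shows "prob {\<omega> \<in> space M. drop_coord n i (\<lambda>j. X j \<omega>) \<in> A} = measure (Pi\<^sub>M {..<n - 1} (\<lambda>_. D)) A"
proof -
  have "measure (Pi\<^sub>M {..<n - 1} (\<lambda>_. D)) A
      = measure (distr M (Pi\<^sub>M {..<n - 1} (\<lambda>_. borel)) (\<lambda>\<omega>. drop_coord n i (\<lambda>j. X j \<omega>))) A"
    by (simp only: law_rest[OF assms(1,2)])
  also have "\<dots> = prob {\<omega> \<in> space M. drop_coord n i (\<lambda>j. X j \<omega>) \<in> A}"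
    by (subst measure_distr[OF drop_coord_measurable A]) (auto intro!: arg_cong[where f=prob])
  finally show ?thesis by simp
qed

lemma prob_coord_and_rest_sum:
  assumes i: "i < n" and n: "n \<ge> 2" and B: "B \<in> sets borel" and C: "C \<in> sets borel"
  shows "prob {\<omega> \<in> space M. X i \<omega> \<in> B \<and> partial_sum X n \<omega> - X i \<omega> \<in> C}
       = measure D B * prob {\<omega> \<in> space M. partial_sum X n \<omega> - X i \<omega> \<in> C}"
proof -
  let ?P = "Pi\<^sub>M {..<n - 1} (\<lambda>_. borel :: real measure)"
  let ?A = "{y \<in> space ?P. (\<Sum>j<n - 1. y j) \<in> C}"
  have A: "?A \<in> sets ?P" using C by measurable
  have "drop_coord n i (\<lambda>j. X j \<omega>) \<in> ?A \<longleftrightarrow> partial_sum X n \<omega> - X i \<omega> \<in> C" for \<omega>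
    using sum_drop_coord[OF i, of "\<lambda>j. X j \<omega>"]
    by (simp add: partial_sum_def space_PiM) (simp add: drop_coord_def)
  then show ?thesis using prob_coord_and_rest[OF i n B A] by simp
qed

end

text \<open>Induction on \<open>I\<close>: a new event loses at most its overlap with the union of
  the earlier ones, that is \<open>card I * u\<close>. The square is a crude count of the pairs; it
  suffices because \<open>u\<close> will be the square of a small quantity.\<close>

lemma (in finite_measure) Bonferroni_lower_bound:
  assumes I: "finite I" and E: "\<And>i. i \<in> I \<Longrightarrow> E i \<in> sets M"
    and U: "\<And>i. i \<in> I \<Longrightarrow> measure M (E i) \<ge> l"
    and V: "\<And>i j. i \<in> I \<Longrightarrow> j \<in> I \<Longrightarrow> i \<noteq> j \<Longrightarrow> measure M (E i \<inter> E j) \<le> u" and u: "0 \<le> u"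
  shows "measure M (\<Union>i\<in>I. E i) \<ge> real (card I) * l - (real (card I))\<^sup>2 * u"
  using assms
proof (induction I rule: finite_induct)
  case empty
  then show ?case by simp
next
  case (insert i I)
  let ?V = "\<Union>j\<in>I. E j"
  have m: "E i \<in> sets M" "?V \<in> sets M" using insert by auto
  have "measure M (E i \<inter> ?V) = measure M (\<Union>j\<in>I. E i \<inter> E j)" by (rule arg_cong[where f="measure M"]) auto
  also have "\<dots> \<le> (\<Sum>j\<in>I. measure M (E i \<inter> E j))"
    using insert by (intro finite_measure_subadditive_finite) auto
  also have "\<dots> \<le> (\<Sum>j\<in>I. u)" using insert.hyps by (intro sum_mono insert.prems) auto
  finally have 1: "measure M (E i \<inter> ?V) \<le> real (card I) * u" by simp
  have "measure M (E i \<union> ?V) = measure M (E i) + measure M ?V - measure M (E i \<inter> ?V)"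
    using m by (simp add: measure_Un3 fmeasurable_eq_sets)
  moreover have "measure M ?V \<ge> real (card I) * l - (real (card I))\<^sup>2 * u"
    using insert by (intro insert.IH) auto
  ultimately have "measure M (E i \<union> ?V) \<ge> l + (real (card I) * l - (real (card I))\<^sup>2 * u) - real (card I) * u"
    using 1 insert.prems(2)[of i] by simp
  moreover have "(real (card I) + 1)\<^sup>2 * u = (real (card I))\<^sup>2 * u + 2 * (real (card I) * u) + u"
    by (simp add: power2_eq_square algebra_simps)
  moreover have "0 \<le> real (card I) * u" using insert.prems by simp
  moreover have "(\<Union>j\<in>insert i I. E j) = E i \<union> ?V" by auto
  moreover have "real (card (insert i I)) = real (card I) + 1" using insert.hyps by simp
  moreover have "(real (card I) + 1) * l = real (card I) * l + l" by (simp add: algebra_simps)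
  ultimately have "(real (card I) + 1) * l - (real (card I) + 1)\<^sup>2 * u \<le> measure M (E i \<union> ?V)"
    using \<open>0 \<le> u\<close> by linarith
  then show ?case using insert.hyps by (simp add: add.commute)
qed


section \<open>Truncated second moments and Chebyshev bounds\<close>

lemma square_le_if_abs_le: "\<bar>x\<bar> \<le> K \<Longrightarrow> x\<^sup>2 \<le> K\<^sup>2" for x K :: real
  using power_mono[of "\<bar>x\<bar>" K 2] by simp

text \<open>The cross terms vanish by independence and centering. Boundedness supplies the
  integrability of all products.\<close>

lemma (in prob_space) second_moment_sum_indep:
  fixes Y :: "'b \<Rightarrow> 'a \<Rightarrow> real"
  assumes "finite I" "indep_vars (\<lambda>_. borel) Y I"
    and bd: "\<And>i \<omega>. i \<in> I \<Longrightarrow> \<bar>Y i \<omega>\<bar> \<le> K" and zero: "\<And>i. i \<in> I \<Longrightarrow> expectation (Y i) = 0"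
  shows "expectation (\<lambda>\<omega>. (\<Sum>i\<in>I. Y i \<omega>)\<^sup>2) = (\<Sum>i\<in>I. expectation (\<lambda>\<omega>. (Y i \<omega>)\<^sup>2))"
  using assms
proof (induction I rule: finite_induct)
  case empty
  then show ?case by simp
next
  case (insert i I)
  let ?S = "\<lambda>\<omega>. \<Sum>j\<in>I. Y j \<omega>"
  have mY [measurable]: "Y j \<in> borel_measurable M" if "j \<in> insert i I" for j
    using insert.prems(1) that by (auto simp: indep_vars_def)
  have mS [measurable]: "?S \<in> borel_measurable M" by (intro borel_measurable_sum mY) auto
  have mi [measurable]: "Y i \<in> borel_measurable M" by (rule mY) simp
  have bS: "\<bar>?S \<omega>\<bar> \<le> real (card I) * K" for \<omega>
  proof -
    have "\<bar>?S \<omega>\<bar> \<le> (\<Sum>j\<in>I. \<bar>Y j \<omega>\<bar>)" by (rule sum_abs)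
    also have "\<dots> \<le> (\<Sum>j\<in>I. K)" using insert.prems(2) by (intro sum_mono) auto
    finally show ?thesis by simp
  qed
  have bi: "\<bar>Y i \<omega>\<bar> \<le> K" for \<omega> using insert.prems(2) by simp
  have int: "integrable M (Y j)" if "j \<in> insert i I" for j
    by (rule integrable_const_bound[where B=K]) (use that insert.prems(2) mY in \<open>auto\<close>)
  have intS: "integrable M ?S" by (intro Bochner_Integration.integrable_sum int) auto
  have int2: "integrable M (\<lambda>\<omega>. (Y i \<omega>)\<^sup>2)"
    by (rule integrable_const_bound[where B="K\<^sup>2"]) (auto intro!: AE_I2 square_le_if_abs_le bi)
  have intS2: "integrable M (\<lambda>\<omega>. (?S \<omega>)\<^sup>2)"
    by (rule integrable_const_bound[where B="(real (card I) * K)\<^sup>2"])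
      (auto intro!: AE_I2 square_le_if_abs_le bS)
  have ind: "indep_var borel (Y i) borel ?S"
    using insert by (intro indep_vars_sum) auto
  have intm: "integrable M (\<lambda>\<omega>. Y i \<omega> * ?S \<omega>)"
    by (rule indep_var_integrable[OF ind int intS]) simp
  have "expectation (\<lambda>\<omega>. Y i \<omega> * ?S \<omega>) = expectation (Y i) * expectation ?S"
    by (rule indep_var_lebesgue_integral[OF ind int intS]) simp
  then have cross: "expectation (\<lambda>\<omega>. Y i \<omega> * ?S \<omega>) = 0" using insert.prems(3) by simp
  have "expectation (\<lambda>\<omega>. (\<Sum>j\<in>insert i I. Y j \<omega>)\<^sup>2)
      = expectation (\<lambda>\<omega>. (Y i \<omega>)\<^sup>2 + (2 * (Y i \<omega> * ?S \<omega>) + (?S \<omega>)\<^sup>2))"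
    using insert.hyps by (intro arg_cong[where f="integral\<^sup>L M"]) (auto simp: fun_eq_iff power2_eq_square algebra_simps)
  also have "\<dots> = expectation (\<lambda>\<omega>. (Y i \<omega>)\<^sup>2) + (2 * expectation (\<lambda>\<omega>. Y i \<omega> * ?S \<omega>) + expectation (\<lambda>\<omega>. (?S \<omega>)\<^sup>2))"
    using int2 intS2 intm by simp
  also have "expectation (\<lambda>\<omega>. (?S \<omega>)\<^sup>2) = (\<Sum>j\<in>I. expectation (\<lambda>\<omega>. (Y j \<omega>)\<^sup>2))"
    using insert.prems by (intro insert.IH indep_vars_subset[OF insert.prems(1)]) auto
  finally show ?case using insert.hyps cross by simp
qed

section \<open>Two-sided tail and truncated second moment of a law on the line\<close>

definition two_sided_tail :: "real measure \<Rightarrow> real \<Rightarrow> real" where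
  "two_sided_tail D t = measure D {y. t \<le> \<bar>y\<bar>}"

text \<open>Large values are set to zero rather than capped at \<open>t\<close>. The strict
  inequality makes the discarded values exactly those counted by
  \<open>two_sided_tail\<close>.\<close>

definition truncate :: "real \<Rightarrow> real \<Rightarrow> real" where
  "truncate t y = (if \<bar>y\<bar> < t then y else 0)"

definition truncated_moment :: "real measure \<Rightarrow> real \<Rightarrow> real" where
  "truncated_moment D t = (\<integral>y. (truncate t y)\<^sup>2 \<partial>D)"

lemma truncate_measurable [measurable]: "truncate t \<in> borel_measurable borel"
  unfolding truncate_def[abs_def] by measurable

lemma abs_truncate_le: "0 \<le> t \<Longrightarrow> \<bar>truncate t y\<bar> \<le> t"
  by (simp add: truncate_def)

context real_distribution
begin

lemma two_sided_tail_antimono: "s \<le> t \<Longrightarrow> two_sided_tail M t \<le> two_sided_tail M s"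
  unfolding two_sided_tail_def by (intro finite_measure_mono) auto

lemma two_sided_tail_nonneg: "0 \<le> two_sided_tail M t"
  by (simp add: two_sided_tail_def)

lemma integrable_truncate_power [simp]: "0 \<le> t \<Longrightarrow> integrable M (\<lambda>y. (truncate t y) ^ k)"
  by (rule integrable_const_bound[where B="t ^ k"])
    (auto simp: power_abs intro!: AE_I2 power_mono abs_truncate_le)

lemma truncated_moment_mono:
  "0 \<le> s \<Longrightarrow> s \<le> t \<Longrightarrow> truncated_moment M s \<le> truncated_moment M t"
  unfolding truncated_moment_def by (intro integral_mono integrable_truncate_power) (auto simp: truncate_def)

lemma truncated_moment_le: "0 \<le> t \<Longrightarrow> truncated_moment M t \<le> t\<^sup>2"
proof -
  assume t: "0 \<le> t"
  have "truncated_moment M t \<le> (\<integral>y. t\<^sup>2 \<partial>M)"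
    unfolding truncated_moment_def using t abs_truncate_le[OF t]
    by (intro integral_mono integrable_truncate_power) (auto simp: abs_le_square_iff[symmetric])
  then show ?thesis using prob_space by simp
qed

text \<open>Values of modulus in \<open>[t, 2 * t)\<close> contribute at most \<open>(2 * t)\<close>
  squared each, and their total mass is at most the tail at \<open>t\<close>.\<close>

lemma truncated_moment_double:
  assumes t: "0 \<le> t"
  shows "truncated_moment M (2 * t) \<le> truncated_moment M t + 4 * t\<^sup>2 * two_sided_tail M t"
proof -
  have "truncated_moment M (2 * t) \<le> (\<integral>y. (truncate t y)\<^sup>2 + 4 * t\<^sup>2 * indicator {y. t \<le> \<bar>y\<bar>} y \<partial>M)"
    unfolding truncated_moment_def
  proof (intro integral_mono integrable_truncate_power Bochner_Integration.integrable_add integrable_mult_right)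
    fix y
    have "\<bar>y\<bar> < 2 * t \<Longrightarrow> y\<^sup>2 \<le> 4 * t\<^sup>2" using abs_le_square_iff[of y "2 * t"] t by auto
    then show "(truncate (2 * t) y)\<^sup>2 \<le> (truncate t y)\<^sup>2 + 4 * t\<^sup>2 * indicator {y. t \<le> \<bar>y\<bar>} y"
      using t by (auto simp: truncate_def indicator_def)
  qed (use t in \<open>auto simp: emeasure_eq_measure\<close>)
  also have "\<dots> = truncated_moment M t + 4 * t\<^sup>2 * two_sided_tail M t"
    using t by (subst Bochner_Integration.integral_add)
      (auto simp: truncated_moment_def two_sided_tail_def emeasure_eq_measure)
  finally show ?thesis .
qed

text \<open>Doubling argument: since \<open>\<alpha> < 2\<close>, the function \<open>t\<^sup>2 * two_sided_tail M t\<close> grows by a factor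
  bounded away from 1 when t is doubled, so that it dominates the sum of its values at
  \<open>t/2, t/4, \<dots>\<close>, which in turn bounds the truncated moment.\<close>

lemma truncated_moment_bound:
  assumes reg: "((\<lambda>t. two_sided_tail M (2 * t) / two_sided_tail M t) \<longlongrightarrow> 2 powr (- \<alpha>)) at_top"
    and pos: "\<And>t. two_sided_tail M t > 0" and \<alpha>: "\<alpha> < 2"
  obtains C T where "C > 0" "T > 0"
    "\<And>t. t \<ge> T \<Longrightarrow> truncated_moment M t \<le> C * t\<^sup>2 * two_sided_tail M t"
proof -
  let ?H = "two_sided_tail M" and ?G = "truncated_moment M"
  \<comment> \<open>The limiting growth factor of the square of \<open>t\<close> times
    \<open>?H t\<close> under doubling. It exceeds 1 because \<open>\<alpha> < 2\<close>, which
    leaves room for \<open>\<rho>\<close> strictly between.\<close>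
  have "4 * 2 powr (- \<alpha>) = 2 powr (2 - \<alpha>)" by (simp add: powr_diff powr_minus field_simps)
  also have "\<dots> > 1" using \<alpha> by simp
  finally obtain \<rho> where \<rho>: "1 < \<rho>" "\<rho> < 4 * 2 powr (- \<alpha>)" using dense by blast
  then have "\<rho> / 4 < 2 powr (- \<alpha>)" by simp
  from order_tendstoD(1)[OF reg this]
  have "eventually (\<lambda>t. t > 0 \<and> \<rho> / 4 < ?H (2 * t) / ?H t) at_top"
    using eventually_gt_at_top[of 0] by eventually_elim auto
  then obtain T where T: "\<And>t. t \<ge> T \<Longrightarrow> t > 0 \<and> \<rho> / 4 < ?H (2 * t) / ?H t"
    by (auto simp: eventually_at_top_linorder)
  have T0: "T > 0" using T[of T] by simp
  have dbl: "\<rho> * (t\<^sup>2 * ?H t) \<le> (2 * t)\<^sup>2 * ?H (2 * t)" if "t \<ge> T" for t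
  proof -
    have "\<rho> * ?H t \<le> 4 * ?H (2 * t)" using T[OF that] pos[of t] by (simp add: field_simps)
    from mult_left_mono[OF this, of "t\<^sup>2"] show ?thesis by (simp add: power2_eq_square algebra_simps)
  qed
  \<comment> \<open>The first entry closes the induction:
    \<open>C * K + 4 * K \<le> C * (\<rho> * K)\<close>. The second covers the initial interval from
    \<open>T\<close> to \<open>2 * T\<close>, where the moment is at most four times the square of
    \<open>T\<close>.\<close>
  define C where "C = max (4 / (\<rho> - 1)) (4 / ?H (2 * T))"
  have C: "C > 0" "4 \<le> C * (\<rho> - 1)" "4 \<le> C * ?H (2 * T)"
    using \<rho> pos[of "2 * T"] by (auto simp: C_def less_max_iff_disj pos_divide_le_eq[symmetric])
  \<comment> \<open>Induction over dyadic ranges: a point outside the current range is halved into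
    it.\<close>
  have main: "?G t \<le> C * t\<^sup>2 * ?H t" if "T \<le> t" "t \<le> 2 ^ Suc k * T" for t k
    using that
  proof (induction k arbitrary: t)
    case 0
    have "?G t \<le> ?G (2 * T)" using 0 T0 by (intro truncated_moment_mono) auto
    also have "\<dots> \<le> 4 * T\<^sup>2" using truncated_moment_le[of "2 * T"] T0 by simp
    also have "\<dots> \<le> (C * ?H (2 * T)) * t\<^sup>2"
      using 0 T0 C by (intro mult_mono power_mono) auto
    also have "\<dots> \<le> (C * ?H t) * t\<^sup>2"
      using 0 C by (intro mult_right_mono mult_left_mono two_sided_tail_antimono) auto
    finally show ?case by (simp add: mult_ac)
  next
    case (Suc k)
    show ?case
    proof (cases "t \<le> 2 ^ Suc k * T")
      case True
      then show ?thesis using Suc by blast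
    next
      case False
      have "1 \<le> (2::real) ^ k" by simp
      then have "T \<le> 2 ^ k * T" using T0 by simp
      then have t2: "T \<le> t / 2" "t / 2 \<le> 2 ^ Suc k * T" using False Suc.prems by simp_all
      let ?K = "(t / 2)\<^sup>2 * ?H (t / 2)"
      have "?G t \<le> ?G (t / 2) + 4 * ?K"
        using truncated_moment_double[of "t / 2"] t2 T0 by (simp add: mult_ac)
      also have "\<dots> \<le> C * ?K + 4 * ?K" using Suc.IH[OF t2] by (simp add: mult_ac)
      also have "\<dots> \<le> C * ?K + (C * (\<rho> - 1)) * ?K"
        using C(2) two_sided_tail_nonneg by (intro add_left_mono mult_right_mono mult_nonneg_nonneg) auto
      also have "\<dots> = C * (\<rho> * ?K)" by (simp add: algebra_simps)
      also have "\<dots> \<le> C * (t\<^sup>2 * ?H t)"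
        using dbl[OF t2(1)] C(1) by (intro mult_left_mono) auto
      finally show ?thesis by (simp add: mult_ac)
    qed
  qed
  show ?thesis
  proof (rule that[OF C(1) T0])
    fix t assume t: "t \<ge> T"
    obtain k where k: "t / T < 2 ^ k" using real_arch_pow[of 2 "t / T"] by auto
    have "t < 2 ^ k * T" using k T0 by (simp add: field_simps)
    also have "\<dots> \<le> 2 ^ Suc k * T" using T0 by simp
    finally show "?G t \<le> C * t\<^sup>2 * ?H t" using main[of t k] t by simp
  qed
qed

end

text \<open>Chebyshev's inequality for the centred truncated summands \<open>Y i\<close>, which are
  bounded and independent. Each variance is estimated by the uncentred second moment.\<close>

lemma (in iid_sequence) truncated_sum_Chebyshev:
  assumes t: "t > 0" and r: "r > 0"
  shows "prob {\<omega> \<in> space M. r \<le> \<bar>(\<Sum>i<n. truncate t (X i \<omega>)) - real n * (\<integral>y. truncate t y \<partial>D)\<bar>}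
     \<le> real n * truncated_moment D t / r\<^sup>2"
proof -
  define m where "m = (\<integral>y. truncate t y \<partial>D)"
  define Y where "Y i \<omega> = truncate t (X i \<omega>) - m" for i \<omega>
  have E: "expectation (\<lambda>\<omega>. f (X i \<omega>)) = (\<integral>y. f y \<partial>D)" if "f \<in> borel_measurable borel" for f :: "real \<Rightarrow> real" and i
    using that by (subst law[of i, symmetric], subst integral_distr) auto
  have int: "integrable M (\<lambda>\<omega>. truncate t (X i \<omega>))" for i
    by (rule integrable_const_bound[where B=t]) (use t in \<open>auto intro!: abs_truncate_le\<close>)
  have int2: "integrable M (\<lambda>\<omega>. (truncate t (X i \<omega>))\<^sup>2)" for i
    by (rule integrable_const_bound[where B="t\<^sup>2"])
      (use t in \<open>auto intro!: AE_I2 square_le_if_abs_le abs_truncate_le\<close>)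
  have indY: "indep_vars (\<lambda>_. borel) Y {..<n}"
    unfolding Y_def by (rule indep_vars_compose2[OF indep_vars_subset[OF indep]]) auto
  have mY [measurable]: "Y i \<in> borel_measurable M" for i unfolding Y_def[abs_def] by measurable
  have bY: "\<bar>Y i \<omega>\<bar> \<le> t + \<bar>m\<bar>" for i \<omega>
    using abs_truncate_le[of t "X i \<omega>"] t unfolding Y_def by linarith
  have zero: "expectation (Y i) = 0" for i
    using int[of i] prob_space unfolding Y_def[abs_def] by (simp add: E m_def)
  have sec: "expectation (\<lambda>\<omega>. (Y i \<omega>)\<^sup>2) \<le> truncated_moment D t" for i
  proof -
    have "expectation (\<lambda>\<omega>. (Y i \<omega>)\<^sup>2) = expectation (\<lambda>\<omega>. (truncate t (X i \<omega>))\<^sup>2 + (- (2 * m) * truncate t (X i \<omega>) + m\<^sup>2))"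
      by (intro arg_cong[where f="integral\<^sup>L M"]) (auto simp: Y_def fun_eq_iff power2_eq_square algebra_simps)
    also have "\<dots> = truncated_moment D t + (- (2 * m) * m + m\<^sup>2)"
      using int[of i] int2[of i] prob_space
      by (simp add: E[of "truncate t"] E[of "\<lambda>y. (truncate t y)\<^sup>2"] truncated_moment_def flip: m_def)
    also have "\<dots> \<le> truncated_moment D t" by (simp add: power2_eq_square)
    finally show ?thesis .
  qed
  have Sint: "integrable M (\<lambda>\<omega>. (\<Sum>i<n. Y i \<omega>)\<^sup>2)"
  proof (rule integrable_const_bound[where B="(\<Sum>i<n. t + \<bar>m\<bar>)\<^sup>2"])
    have "\<bar>\<Sum>i<n. Y i \<omega>\<bar> \<le> (\<Sum>i<n. t + \<bar>m\<bar>)" for \<omega>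
      by (rule order_trans[OF sum_abs sum_mono[OF bY]])
    then show "AE \<omega> in M. norm ((\<Sum>i<n. Y i \<omega>)\<^sup>2) \<le> (\<Sum>i<n. t + \<bar>m\<bar>)\<^sup>2"
      by (intro AE_I2) (metis abs_ge_zero norm_power power_mono real_norm_def)
  qed simp
  have "prob {\<omega> \<in> space M. r \<le> \<bar>\<Sum>i<n. Y i \<omega>\<bar>} \<le> expectation (\<lambda>\<omega>. (\<Sum>i<n. Y i \<omega>)\<^sup>2) / r\<^sup>2"
    by (rule second_moment_method[OF _ Sint r]) simp
  also have "expectation (\<lambda>\<omega>. (\<Sum>i<n. Y i \<omega>)\<^sup>2) = (\<Sum>i<n. expectation (\<lambda>\<omega>. (Y i \<omega>)\<^sup>2))"
    using indY bY zero by (intro second_moment_sum_indep) auto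
  also have "(\<Sum>i<n. expectation (\<lambda>\<omega>. (Y i \<omega>)\<^sup>2)) / r\<^sup>2 \<le> (\<Sum>i<n. truncated_moment D t) / r\<^sup>2"
    by (intro divide_right_mono sum_mono sec) simp
  finally show ?thesis
    by (simp add: Y_def sum_subtractf m_def)
qed


section \<open>Inequalities for a fixed number of summands\<close>

text \<open>The closed tail matches the events with \<open>\<ge>\<close> in the theorem; the open
  tail \<open>1 - cdf\<close> of the hypotheses is compared with it in
  \<open>right_tail_equiv\<close>.\<close>

definition right_tail :: "real measure \<Rightarrow> real \<Rightarrow> real" where
  "right_tail D t = measure D {t..}"

context real_distribution
begin

lemma right_tail_antimono: "s \<le> t \<Longrightarrow> right_tail M t \<le> right_tail M s"
  unfolding right_tail_def by (intro finite_measure_mono) auto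

lemma right_tail_nonneg: "0 \<le> right_tail M t"
  by (simp add: right_tail_def)

lemma right_tail_le_two_sided: "right_tail M t \<le> two_sided_tail M t"
  unfolding right_tail_def two_sided_tail_def by (intro finite_measure_mono) auto

end

context prob_space
begin

lemma prob_exists_le:
  assumes "\<And>i. i < n \<Longrightarrow> {\<omega> \<in> space M. P i \<omega>} \<in> events"
    and "\<And>i. i < n \<Longrightarrow> prob {\<omega> \<in> space M. P i \<omega>} \<le> l"
  shows "prob {\<omega> \<in> space M. \<exists>i<n. P i \<omega>} \<le> real n * l"
proof -
  have "{\<omega> \<in> space M. \<exists>i<n. P i \<omega>} = (\<Union>i<n. {\<omega> \<in> space M. P i \<omega>})" by auto
  then have "prob {\<omega> \<in> space M. \<exists>i<n. P i \<omega>} \<le> (\<Sum>i<n. prob {\<omega> \<in> space M. P i \<omega>})"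
    using assms(1) finite_measure_subadditive_finite[of "{..<n}" "\<lambda>i. {\<omega> \<in> space M. P i \<omega>}"] by auto
  also have "\<dots> \<le> (\<Sum>i<n. l)" using assms(2) by (intro sum_mono) auto
  finally show ?thesis by simp
qed

lemma measure_cond_law:
  assumes "E \<in> events" "f \<in> measurable M N" "A \<in> sets N" "prob E > 0"
  shows "measure (cond_law M E N f) A = prob {\<omega> \<in> E. f \<omega> \<in> A} / prob E"
proof -
  have E: "emeasure M E \<noteq> 0" "emeasure M E \<noteq> \<infinity>" using assms(4) by (auto simp: emeasure_eq_measure)
  have "measure (cond_law M E N f) A = measure (uniform_measure M E) (f -` A \<inter> space M)"
    unfolding cond_law_def using assms by (subst measure_distr) auto
  also have "\<dots> = prob (E \<inter> (f -` A \<inter> space M)) / prob E"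
    using assms E by (intro measure_uniform_measure) auto
  also have "E \<inter> (f -` A \<inter> space M) = {\<omega> \<in> E. f \<omega> \<in> A}"
    using sets.sets_into_space[OF assms(1)] by auto
  finally show ?thesis .
qed

end

lemma sets_cond_law [simp]: "sets (cond_law M E N f) = sets N"
  by (simp add: cond_law_def)

section \<open>One big jump, and the law of the other coordinates\<close>

context iid_sequence
begin

lemma prob_X_ge: "prob {\<omega> \<in> space M. X i \<omega> \<ge> t} = right_tail D t"
  using prob_X[of "{t..}" i] by (simp add: right_tail_def)

lemma prob_abs_X_ge: "prob {\<omega> \<in> space M. \<bar>X i \<omega>\<bar> \<ge> t} = two_sided_tail D t"
  using prob_X[of "{y. t \<le> \<bar>y\<bar>}" i] by (simp add: two_sided_tail_def)

lemma partial_max_ge_iff: "n \<ge> 1 \<Longrightarrow> partial_max X n \<omega> \<ge> t \<longleftrightarrow> (\<exists>i<n. X i \<omega> \<ge> t)"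
  unfolding partial_max_def by (subst Max_ge_iff) (auto simp: lessThan_empty_iff)

lemma prob_partial_max_ge_le:
  assumes "n \<ge> 1"
  shows "prob {\<omega> \<in> space M. partial_max X n \<omega> \<ge> t} \<le> real n * right_tail D t"
  unfolding partial_max_ge_iff[OF assms] by (rule prob_exists_le) (auto simp: prob_X_ge)

definition deviation :: "nat \<Rightarrow> real \<Rightarrow> real \<Rightarrow> real" where
  "deviation n c r = prob {\<omega> \<in> space M. \<bar>partial_sum X n \<omega> - c\<bar> \<ge> r}"

text \<open>Tightness is available for the full sum only; this transfers it to the sum without one
  coordinate, at the price of a single tail. Half of \<open>r\<close> is allotted to each.\<close>

lemma prob_rest_deviation_le:
  "prob {\<omega> \<in> space M. \<bar>partial_sum X n \<omega> - X i \<omega> - c\<bar> \<ge> r}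
     \<le> deviation n c (r / 2) + two_sided_tail D (r / 2)"
proof -
  have "prob {\<omega> \<in> space M. \<bar>partial_sum X n \<omega> - X i \<omega> - c\<bar> \<ge> r}
      \<le> prob ({\<omega> \<in> space M. \<bar>partial_sum X n \<omega> - c\<bar> \<ge> r / 2} \<union> {\<omega> \<in> space M. \<bar>X i \<omega>\<bar> \<ge> r / 2})"
  proof (rule finite_measure_mono, safe)
    fix \<omega> assume "r \<le> \<bar>partial_sum X n \<omega> - X i \<omega> - c\<bar>" "\<not> r / 2 \<le> \<bar>X i \<omega>\<bar>"
    then show "r / 2 \<le> \<bar>partial_sum X n \<omega> - c\<bar>" by linarith
  qed measurable
  also have "\<dots> \<le> prob {\<omega> \<in> space M. \<bar>partial_sum X n \<omega> - c\<bar> \<ge> r / 2} + prob {\<omega> \<in> space M. \<bar>X i \<omega>\<bar> \<ge> r / 2}"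
    by (rule measure_Un_le) auto
  finally show ?thesis unfolding deviation_def prob_abs_X_ge .
qed

text \<open>On \<open>E i\<close> coordinate \<open>i\<close> is at least \<open>u\<close> and the
  other coordinates sum to within \<open>v\<close> of \<open>c\<close>. Independence makes its
  probability a product, and Bonferroni subtracts the outcomes with two jumps.\<close>

lemma one_big_jump_lower:
  assumes n: "n \<ge> 2"
  shows "prob {\<omega> \<in> space M. partial_sum X n \<omega> - c \<ge> u - v \<and> partial_max X n \<omega> \<ge> u}
    \<ge> real n * right_tail D u * (1 - deviation n c (v / 2) - two_sided_tail D (v / 2))
      - (real n * right_tail D u)\<^sup>2"
proof -
  define E where "E i = {\<omega> \<in> space M. X i \<omega> \<in> {u..} \<and> partial_sum X n \<omega> - X i \<omega> \<in> {c - v<..<c + v}}" for i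
  have mE: "E i \<in> events" for i unfolding E_def by measurable
  have "real n * (right_tail D u * (1 - deviation n c (v / 2) - two_sided_tail D (v / 2)))
      - (real n)\<^sup>2 * (right_tail D u)\<^sup>2 \<le> prob (\<Union>i<n. E i)"
  proof (rule order_trans[OF _ Bonferroni_lower_bound])
    fix i assume i: "i \<in> {..<n}"
    have "prob {\<omega> \<in> space M. partial_sum X n \<omega> - X i \<omega> \<in> {c - v<..<c + v}}
        = prob (space M - {\<omega> \<in> space M. \<bar>partial_sum X n \<omega> - X i \<omega> - c\<bar> \<ge> v})"
      by (rule arg_cong[where f=prob]) auto
    also have "\<dots> = 1 - prob {\<omega> \<in> space M. \<bar>partial_sum X n \<omega> - X i \<omega> - c\<bar> \<ge> v}"
      by (rule prob_compl) measurable
    finally have "1 - deviation n c (v / 2) - two_sided_tail D (v / 2)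
       \<le> prob {\<omega> \<in> space M. partial_sum X n \<omega> - X i \<omega> \<in> {c - v<..<c + v}}"
      using prob_rest_deviation_le[of v n i c] by linarith
    then show "right_tail D u * (1 - deviation n c (v / 2) - two_sided_tail D (v / 2)) \<le> prob (E i)"
      using i n unfolding E_def
      by (subst prob_coord_and_rest_sum) (auto simp: right_tail_def intro!: mult_left_mono)
  next
    fix i j :: nat assume "i \<noteq> j"
    have "prob (E i \<inter> E j) \<le> prob {\<omega> \<in> space M. X i \<omega> \<in> {u..} \<and> X j \<omega> \<in> {u..}}"
      by (rule finite_measure_mono) (auto simp: E_def)
    also have "\<dots> = (right_tail D u)\<^sup>2"
      using \<open>i \<noteq> j\<close> by (subst prob_pair) (auto simp: right_tail_def power2_eq_square)
    finally show "prob (E i \<inter> E j) \<le> (right_tail D u)\<^sup>2" .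
  qed (use mE in auto)
  also have "prob (\<Union>i<n. E i) \<le> prob {\<omega> \<in> space M. partial_sum X n \<omega> - c \<ge> u - v \<and> partial_max X n \<omega> \<ge> u}"
    using n by (intro finite_measure_mono) (auto simp: E_def partial_max_ge_iff)
  finally show ?thesis by (simp add: power_mult_distrib mult_ac)
qed

text \<open>The three terms bound \<open>?A\<close> (a summand of almost full size),
  \<open>?B\<close> (a summand above \<open>z\<close> together with a deviation of the rest) and
  \<open>?C\<close> (a deviation of the truncated sum). The mean uses up at most
  \<open>x / 2\<close>, so Chebyshev is applied at \<open>x / 2\<close>; this is the factor
  4.\<close>

lemma one_big_jump_upper:
  assumes n: "n \<ge> 2" and x: "x > 0" and z: "z > 0" and m: "\<bar>real n * (\<integral>y. truncate z y \<partial>D) - c\<bar> \<le> x / 2"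
  shows "prob {\<omega> \<in> space M. partial_sum X n \<omega> - c \<ge> x}
    \<le> real n * right_tail D (x - r)
      + real n * (right_tail D z * (deviation n c (r / 2) + two_sided_tail D (r / 2)))
      + 4 * real n * truncated_moment D z / x\<^sup>2"
proof -
  let ?m = "real n * (\<integral>y. truncate z y \<partial>D)"
  let ?A = "{\<omega> \<in> space M. \<exists>i<n. X i \<omega> \<ge> x - r}"
  let ?B = "{\<omega> \<in> space M. \<exists>i<n. X i \<omega> \<in> {z..} \<and> partial_sum X n \<omega> - X i \<omega> \<in> {c + r..}}"
  let ?C = "{\<omega> \<in> space M. x / 2 \<le> \<bar>(\<Sum>i<n. truncate z (X i \<omega>)) - ?m\<bar>}"
  have "{\<omega> \<in> space M. partial_sum X n \<omega> - c \<ge> x} \<subseteq> (?A \<union> ?B) \<union> ?C"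
  proof
    fix \<omega> assume "\<omega> \<in> {\<omega> \<in> space M. partial_sum X n \<omega> - c \<ge> x}"
    then have \<omega>: "\<omega> \<in> space M" "partial_sum X n \<omega> - c \<ge> x" by auto
    show "\<omega> \<in> (?A \<union> ?B) \<union> ?C"
    proof (cases "\<exists>i<n. X i \<omega> \<ge> z")
      case True
      then obtain i where i: "i < n" "X i \<omega> \<ge> z" by blast
      show ?thesis
      proof (cases "X i \<omega> \<ge> x - r")
        case True
        then show ?thesis using i \<omega> by blast
      next
        case False
        then have "partial_sum X n \<omega> - X i \<omega> \<in> {c + r..}" "X i \<omega> \<in> {z..}" using \<omega> i by auto
        then show ?thesis using i \<omega> by blast
      qed
    next
      case False
      \<comment> \<open>With no summand reaching \<open>z\<close>, truncation only replaces values
        at most \<open>- z\<close> by zero and therefore cannot decrease the sum.\<close>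
      have "partial_sum X n \<omega> \<le> (\<Sum>i<n. truncate z (X i \<omega>))"
        unfolding partial_sum_def using False z by (intro sum_mono) (force simp: truncate_def not_le)
      then have "x / 2 \<le> \<bar>(\<Sum>i<n. truncate z (X i \<omega>)) - ?m\<bar>" using \<omega> m by linarith
      then show ?thesis using \<omega>(1) by blast
    qed
  qed
  then have "prob {\<omega> \<in> space M. partial_sum X n \<omega> - c \<ge> x} \<le> prob ((?A \<union> ?B) \<union> ?C)"
    by (rule finite_measure_mono) measurable
  also have "\<dots> \<le> prob (?A \<union> ?B) + prob ?C" by (rule measure_Un_le) measurable
  also have "prob (?A \<union> ?B) \<le> prob ?A + prob ?B" by (rule measure_Un_le) measurable
  also have "prob ?A \<le> real n * right_tail D (x - r)"
    by (rule prob_exists_le) (auto simp: prob_X_ge)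
  also have "prob ?B \<le> real n * (right_tail D z * (deviation n c (r / 2) + two_sided_tail D (r / 2)))"
  proof (rule prob_exists_le)
    fix i assume i: "i < n"
    have "prob {\<omega> \<in> space M. partial_sum X n \<omega> - X i \<omega> \<in> {c + r..}}
        \<le> prob {\<omega> \<in> space M. \<bar>partial_sum X n \<omega> - X i \<omega> - c\<bar> \<ge> r}"
      by (rule finite_measure_mono) auto
    also note prob_rest_deviation_le
    finally show "prob {\<omega> \<in> space M. X i \<omega> \<in> {z..} \<and> partial_sum X n \<omega> - X i \<omega> \<in> {c + r..}}
       \<le> right_tail D z * (deviation n c (r / 2) + two_sided_tail D (r / 2))"
      using i n by (subst prob_coord_and_rest_sum) (auto simp: right_tail_def intro!: mult_left_mono)
  qed measurable
  also have "prob ?C \<le> real n * truncated_moment D z / (x / 2)\<^sup>2"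
    using x z by (intro truncated_sum_Chebyshev) auto
  also have "real n * truncated_moment D z / (x / 2)\<^sup>2 = 4 * real n * truncated_moment D z / x\<^sup>2"
    by (simp add: power_divide)
  finally show ?thesis by simp
qed

text \<open>If the three exceptional probabilities add up to less than 1, there is an outcome at which
  the sum equals the truncated sum and both centerings are close to it, hence to each other.\<close>

lemma truncated_mean_close:
  assumes r: "r > 0" and z: "z > 0"
    and small: "4 * real n * truncated_moment D z / r\<^sup>2 + real n * two_sided_tail D z + deviation n c (r / 2) < 1"
  shows "\<bar>real n * (\<integral>y. truncate z y \<partial>D) - c\<bar> \<le> r"
proof -
  let ?m = "real n * (\<integral>y. truncate z y \<partial>D)"
  let ?A = "{\<omega> \<in> space M. r / 2 \<le> \<bar>(\<Sum>i<n. truncate z (X i \<omega>)) - ?m\<bar>}"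
  let ?B = "{\<omega> \<in> space M. \<exists>i<n. \<bar>X i \<omega>\<bar> \<ge> z}"
  let ?C = "{\<omega> \<in> space M. \<bar>partial_sum X n \<omega> - c\<bar> \<ge> r / 2}"
  have "prob ((?A \<union> ?B) \<union> ?C) \<le> prob (?A \<union> ?B) + prob ?C" by (rule measure_Un_le) measurable
  also have "prob (?A \<union> ?B) \<le> prob ?A + prob ?B" by (rule measure_Un_le) measurable
  also have "prob ?A \<le> real n * truncated_moment D z / (r / 2)\<^sup>2"
    using r z by (intro truncated_sum_Chebyshev) auto
  also have "real n * truncated_moment D z / (r / 2)\<^sup>2 = 4 * real n * truncated_moment D z / r\<^sup>2"
    by (simp add: power_divide)
  also have "prob ?B \<le> real n * two_sided_tail D z"
    by (rule prob_exists_le) (auto simp: prob_abs_X_ge)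
  also have "prob ?C = deviation n c (r / 2)" by (simp add: deviation_def)
  finally have "prob ((?A \<union> ?B) \<union> ?C) < 1" using small by linarith
  then have "(?A \<union> ?B) \<union> ?C \<noteq> space M" using prob_space by auto
  then obtain \<omega> where "\<omega> \<in> space M" "\<omega> \<notin> ?A" "\<omega> \<notin> ?B" "\<omega> \<notin> ?C" by blast
  then have \<omega>: "\<bar>(\<Sum>i<n. truncate z (X i \<omega>)) - ?m\<bar> < r / 2" "\<And>i. i < n \<Longrightarrow> \<bar>X i \<omega>\<bar> < z"
    "\<bar>partial_sum X n \<omega> - c\<bar> < r / 2"
    by (auto simp: not_le)
  have "(\<Sum>i<n. truncate z (X i \<omega>)) = partial_sum X n \<omega>"
    unfolding partial_sum_def using \<omega>(2) by (intro sum.cong) (auto simp: truncate_def)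
  then show ?thesis using \<omega> by linarith
qed

text \<open>Summing over the position \<open>k\<close> of the maximum: coordinate \<open>k\<close>
  is at least \<open>x\<close> and, independently, the vector without it lies in
  \<open>A\<close>.\<close>

lemma prob_delete_max_le:
  assumes n: "n \<ge> 2" and A: "A \<in> sets (Pi\<^sub>M {..<n - 1} (\<lambda>_. borel))"
  shows "prob {\<omega> \<in> space M. delete_max n (\<lambda>i. X i \<omega>) \<in> A \<and> partial_max X n \<omega> \<ge> x}
    \<le> real n * right_tail D x * measure (Pi\<^sub>M {..<n - 1} (\<lambda>_. D)) A"
proof -
  let ?P = "\<lambda>i \<omega>. X i \<omega> \<in> {x..} \<and> drop_coord n i (\<lambda>j. X j \<omega>) \<in> A"
  have mP: "{\<omega> \<in> space M. ?P i \<omega>} \<in> events" for i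
    using A by measurable
  have "{\<omega> \<in> space M. \<exists>i<n. ?P i \<omega>} = (\<Union>i<n. {\<omega> \<in> space M. ?P i \<omega>})" by auto
  then have mEx: "{\<omega> \<in> space M. \<exists>i<n. ?P i \<omega>} \<in> events" using mP by auto
  have "prob {\<omega> \<in> space M. delete_max n (\<lambda>i. X i \<omega>) \<in> A \<and> partial_max X n \<omega> \<ge> x}
      \<le> prob {\<omega> \<in> space M. \<exists>i<n. ?P i \<omega>}"
  proof (rule finite_measure_mono[OF _ mEx], safe)
    fix \<omega> assume *: "delete_max n (\<lambda>i. X i \<omega>) \<in> A" "partial_max X n \<omega> \<ge> x"
    obtain k where "k < n" "X k \<omega> = Max ((\<lambda>i. X i \<omega>) ` {..<n})"
      "delete_max n (\<lambda>i. X i \<omega>) = drop_coord n k (\<lambda>i. X i \<omega>)"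
      using delete_max_argmax[of n "\<lambda>i. X i \<omega>"] n by auto
    then show "\<exists>i<n. ?P i \<omega>" using * by (auto simp: partial_max_def)
  qed
  also have "\<dots> \<le> real n * (right_tail D x * measure (Pi\<^sub>M {..<n - 1} (\<lambda>_. D)) A)"
  proof (intro prob_exists_le mP)
    fix i assume "i < n"
    then show "prob {\<omega> \<in> space M. ?P i \<omega>} \<le> right_tail D x * measure (Pi\<^sub>M {..<n - 1} (\<lambda>_. D)) A"
      unfolding right_tail_def by (subst prob_coord_and_rest[OF _ n _ A]) (simp_all only: prob_rest[OF _ n A] atLeast_borel order_refl)
  qed
  finally show ?thesis by (simp add: mult_ac)
qed

lemma sets_PiM_D: "sets (Pi\<^sub>M I (\<lambda>_. D)) = sets (Pi\<^sub>M I (\<lambda>_. borel))"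
  by (intro sets_PiM_cong) auto

lemma prob_space_PiM_D: "prob_space (Pi\<^sub>M I (\<lambda>_. D))"
  by (rule prob_space_PiM) (rule D.prob_space_axioms)

lemma measure_PiM_D_le_1: "measure (Pi\<^sub>M I (\<lambda>_. D)) A \<le> 1"
  using prob_space_PiM_D[of I] by (rule prob_space.prob_le_1)

text \<open>A one-sided estimate valid for every measurable set, applied to a set and to its
  complement, gives a two-sided estimate uniform in \<open>A\<close>. The two error terms are
  exactly what the tail asymptotics control.\<close>

lemma cond_law_delete_max_close:
  fixes x c :: real
  defines "E \<equiv> \<lambda>n. {\<omega> \<in> space M. partial_sum X n \<omega> - c \<ge> x}"
  assumes n: "n \<ge> 2" and A: "A \<in> sets (Pi\<^sub>M {..<n - 1} (\<lambda>_. borel))" and pos: "prob (E n) > 0"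
  shows "\<bar>measure (cond_law M (E n) (Pi\<^sub>M {..<n - 1} (\<lambda>_. borel)) (\<lambda>\<omega>. delete_max n (\<lambda>i. X i \<omega>))) A
          - measure (Pi\<^sub>M {..<n - 1} (\<lambda>_. D)) A\<bar>
    \<le> \<bar>real n * right_tail D x / prob (E n) - 1\<bar>
      + (1 - prob {\<omega> \<in> space M. partial_sum X n \<omega> - c \<ge> x \<and> partial_max X n \<omega> \<ge> x} / prob (E n))"
    (is "_ \<le> \<bar>?w / ?A - 1\<bar> + (1 - ?B / ?A)")
proof -
  let ?N = "Pi\<^sub>M {..<n - 1} (\<lambda>_. borel :: real measure)" and ?Q = "Pi\<^sub>M {..<n - 1} (\<lambda>_. D)"
  let ?P = "cond_law M (E n) ?N (\<lambda>\<omega>. delete_max n (\<lambda>i. X i \<omega>))"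
  interpret Q: prob_space ?Q by (rule prob_space_PiM_D)
  have mE [measurable]: "E n \<in> events" unfolding E_def by measurable
  have *: "measure ?P A - measure ?Q A \<le> \<bar>?w / ?A - 1\<bar> + (1 - ?B / ?A)" if A: "A \<in> sets ?N" for A
  proof -
    let ?R = "{\<omega> \<in> space M. delete_max n (\<lambda>i. X i \<omega>) \<in> A \<and> partial_max X n \<omega> \<ge> x}"
    let ?BE = "{\<omega> \<in> space M. partial_sum X n \<omega> - c \<ge> x \<and> partial_max X n \<omega> \<ge> x}"
    have mR: "?R \<in> events" using A by measurable
    \<comment> \<open>Outcomes with a large sum but without a large maximum are discarded into
      \<open>E n - ?BE\<close>, at cost \<open>?A - ?B\<close>.\<close>
    have "prob {\<omega> \<in> E n. delete_max n (\<lambda>i. X i \<omega>) \<in> A} \<le> prob (?R \<union> (E n - ?BE))"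
      using mR by (intro finite_measure_mono) (auto simp: E_def)
    also have "\<dots> \<le> prob ?R + prob (E n - ?BE)"
      using mR by (intro measure_Un_le) auto
    also have "prob (E n - ?BE) = ?A - ?B"
      by (intro finite_measure_Diff) (auto simp: E_def)
    also have "prob ?R \<le> ?w * measure ?Q A" by (rule prob_delete_max_le[OF n A])
    finally have "prob {\<omega> \<in> E n. delete_max n (\<lambda>i. X i \<omega>) \<in> A} \<le> ?w * measure ?Q A + (?A - ?B)" by simp
    then have "measure ?P A \<le> (?w * measure ?Q A + (?A - ?B)) / ?A"
      using pos by (subst measure_cond_law[OF mE delete_max_measurable A pos]) (intro divide_right_mono, auto)
    also have "\<dots> = (?w / ?A) * measure ?Q A + (1 - ?B / ?A)" using pos by (simp add: field_simps)
    finally have "measure ?P A - measure ?Q A \<le> (?w / ?A - 1) * measure ?Q A + (1 - ?B / ?A)"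
      by (simp add: algebra_simps)
    also have "(?w / ?A - 1) * measure ?Q A \<le> \<bar>?w / ?A - 1\<bar> * 1"
      by (intro mult_mono abs_ge_self measure_PiM_D_le_1 abs_ge_zero measure_nonneg)
    finally show ?thesis by simp
  qed
  have compl: "measure ?P (space ?N - A) = 1 - measure ?P A"
  proof -
    have "prob {\<omega> \<in> E n. delete_max n (\<lambda>i. X i \<omega>) \<in> space ?N - A}
        = prob (E n - {\<omega> \<in> E n. delete_max n (\<lambda>i. X i \<omega>) \<in> A})"
      using measurable_space[OF delete_max_measurable[of n]] sets.sets_into_space[OF mE]
      by (intro arg_cong[where f=prob]) auto
    also have "\<dots> = prob (E n) - prob {\<omega> \<in> E n. delete_max n (\<lambda>i. X i \<omega>) \<in> A}"
    proof (rule finite_measure_Diff)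
      have "{\<omega> \<in> E n. delete_max n (\<lambda>i. X i \<omega>) \<in> A} = E n \<inter> ((\<lambda>\<omega>. delete_max n (\<lambda>i. X i \<omega>)) -` A \<inter> space M)"
        using sets.sets_into_space[OF mE] by auto
      then show "{\<omega> \<in> E n. delete_max n (\<lambda>i. X i \<omega>) \<in> A} \<in> events"
        using measurable_sets[OF delete_max_measurable A] mE by auto
    qed (use mE in auto)
    finally have "prob {\<omega> \<in> E n. delete_max n (\<lambda>i. X i \<omega>) \<in> space ?N - A}
      = prob (E n) - prob {\<omega> \<in> E n. delete_max n (\<lambda>i. X i \<omega>) \<in> A}" .
    moreover have "space ?N - A \<in> sets ?N" using A by auto
    ultimately show ?thesis
      using A pos mE delete_max_measurable[of n] by (simp add: measure_cond_law diff_divide_distrib del: One_nat_def)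
  qed
  have "measure ?Q (space ?Q - A) = 1 - measure ?Q A"
    using A by (intro Q.prob_compl) (simp add: sets_PiM_D)
  moreover have "space ?Q = space ?N" by (rule sets_eq_imp_space_eq[OF sets_PiM_D])
  ultimately have complQ: "measure ?Q (space ?N - A) = 1 - measure ?Q A" by simp
  show ?thesis
    using *[OF A] *[of "space ?N - A"] A compl complQ by (auto simp: abs_le_iff simp del: One_nat_def)
qed

end


section \<open>Asymptotics in the domain of attraction of a stable law\<close>

lemma filterlim_scale: "c > 0 \<Longrightarrow> filterlim (\<lambda>t. c * t :: real) at_top at_top"
  by (rule filterlim_tendsto_pos_mult_at_top[OF tendsto_const _ filterlim_ident])

lemma tendsto_1I:
  fixes f :: "nat \<Rightarrow> real"
  assumes "\<And>\<epsilon>. \<epsilon> > 0 \<Longrightarrow> eventually (\<lambda>n. f n > 1 - \<epsilon>) sequentially"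
    "\<And>\<epsilon>. \<epsilon> > 0 \<Longrightarrow> eventually (\<lambda>n. f n < 1 + \<epsilon>) sequentially"
  shows "f \<longlonglongrightarrow> 1"
proof (rule order_tendstoI)
  fix y :: real
  show "y < 1 \<Longrightarrow> eventually (\<lambda>n. y < f n) sequentially" using assms(1)[of "1 - y"] by simp
  show "1 < y \<Longrightarrow> eventually (\<lambda>n. f n < y) sequentially" using assms(2)[of "y - 1"] by simp
qed

text \<open>The slowly varying function has been eliminated in favour of ratios of tails, and the
  stable limit is present only through \<open>tight\<close>.\<close>

locale heavy_tailed_sums = iid_sequence M X D for M :: "'a measure" and X and D +
  fixes \<alpha> p :: real and a b :: "nat \<Rightarrow> real"
  assumes \<alpha>: "0 < \<alpha>" "\<alpha> < 2" and p: "p > 0"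
    and tail_balance: "((\<lambda>t. right_tail D t / two_sided_tail D t) \<longlongrightarrow> p) at_top"
    and tail_regular: "\<And>c. c > 0 \<Longrightarrow>
      ((\<lambda>t. two_sided_tail D (c * t) / two_sided_tail D t) \<longlongrightarrow> c powr (- \<alpha>)) at_top"
    and tail_pos: "\<And>t. two_sided_tail D t > 0"
    and a_pos: "eventually (\<lambda>n. a n > 0) sequentially"
    and a_lim: "filterlim a at_top sequentially"
    and a_norm: "(\<lambda>n. real n * two_sided_tail D (a n)) \<longlonglongrightarrow> 1"
    and tight: "\<And>\<eta>. \<eta> > 0 \<Longrightarrow>
      \<exists>K>0. eventually (\<lambda>n. deviation n (b n) (K * a n) \<le> \<eta>) sequentially"
begin

lemma right_tail_pos: "right_tail D t > 0"
proof -
  have "eventually (\<lambda>s. s \<ge> t \<and> 0 < right_tail D s / two_sided_tail D s) at_top"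
    using order_tendstoD(1)[OF tail_balance p] eventually_ge_at_top[of t] by eventually_elim auto
  then obtain s where "s \<ge> t" "0 < right_tail D s / two_sided_tail D s"
    using eventually_happens'[OF trivial_limit_at_top_linorder] by blast
  then show ?thesis using tail_pos[of s] D.right_tail_antimono[of t s] by (simp add: zero_less_divide_iff)
qed

lemma right_tail_regular:
  assumes c: "c > 0"
  shows "((\<lambda>t. right_tail D (c * t) / right_tail D t) \<longlongrightarrow> c powr (- \<alpha>)) at_top"
proof -
  have "((\<lambda>t. right_tail D (c * t) / two_sided_tail D (c * t) *
      (two_sided_tail D (c * t) / two_sided_tail D t) / (right_tail D t / two_sided_tail D t))
      \<longlongrightarrow> p * c powr (- \<alpha>) / p) at_top"
    using p by (intro tendsto_intros tail_regular c tail_balance filterlim_compose[OF tail_balance filterlim_scale]) auto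
  moreover have "right_tail D (c * t) / two_sided_tail D (c * t) *
      (two_sided_tail D (c * t) / two_sided_tail D t) / (right_tail D t / two_sided_tail D t)
      = right_tail D (c * t) / right_tail D t" for t
    using tail_pos[of t] tail_pos[of "c * t"] by simp
  moreover have "p * c powr (- \<alpha>) / p = c powr (- \<alpha>)" using p by simp
  ultimately show ?thesis by (simp only:)
qed

lemma two_sided_tail_at_a:
  assumes K: "K > 0"
  shows "(\<lambda>n. real n * two_sided_tail D (K * a n)) \<longlonglongrightarrow> K powr (- \<alpha>)"
proof -
  have "(\<lambda>n. real n * two_sided_tail D (a n) * (two_sided_tail D (K * a n) / two_sided_tail D (a n)))
      \<longlonglongrightarrow> 1 * K powr (- \<alpha>)"
    by (intro tendsto_intros a_norm filterlim_compose[OF tail_regular[OF K] a_lim])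
  moreover have "real n * two_sided_tail D (a n) * (two_sided_tail D (K * a n) / two_sided_tail D (a n))
      = real n * two_sided_tail D (K * a n)" for n
    using tail_pos[of "a n"] by simp
  ultimately show ?thesis by simp
qed

lemma right_tail_at_a:
  assumes K: "K > 0"
  shows "(\<lambda>n. real n * right_tail D (K * a n)) \<longlonglongrightarrow> p * K powr (- \<alpha>)"
proof -
  have "(\<lambda>n. right_tail D (K * a n) / two_sided_tail D (K * a n) * (real n * two_sided_tail D (K * a n)))
      \<longlonglongrightarrow> p * K powr (- \<alpha>)"
    by (intro tendsto_mult two_sided_tail_at_a[OF K]
        filterlim_compose[OF tail_balance filterlim_compose[OF filterlim_scale[OF K] a_lim]])
  moreover have "right_tail D (K * a n) / two_sided_tail D (K * a n) * (real n * two_sided_tail D (K * a n))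
      = real n * right_tail D (K * a n)" for n
    using tail_pos[of "K * a n"] by simp
  ultimately show ?thesis by simp
qed

text \<open>Dividing \<open>a_norm\<close> by \<open>n\<close> gives the limit along
  \<open>a n\<close>; monotonicity extends it to the real variable.\<close>

lemma two_sided_tail_lim: "(two_sided_tail D \<longlongrightarrow> 0) at_top"
proof -
  have "(\<lambda>n. real n * two_sided_tail D (a n) * inverse (real n)) \<longlonglongrightarrow> 1 * 0"
    by (intro tendsto_intros a_norm lim_inverse_n)
  then have "(\<lambda>n. two_sided_tail D (a n)) \<longlonglongrightarrow> 1 * 0"
    by (rule Lim_transform_eventually) (use eventually_gt_at_top[of 0] in \<open>eventually_elim; simp\<close>)
  then have lim: "(\<lambda>n. two_sided_tail D (a n)) \<longlonglongrightarrow> 0" by simp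
  show ?thesis
  proof (rule order_tendstoI)
    fix e :: real assume "e > 0"
    from order_tendstoD(2)[OF lim this] obtain n where n: "two_sided_tail D (a n) < e"
      using eventually_happens'[OF sequentially_bot] by blast
    show "eventually (\<lambda>t. two_sided_tail D t < e) at_top"
      using eventually_ge_at_top[of "a n"]
      by eventually_elim (use n D.two_sided_tail_antimono in \<open>blast intro: le_less_trans\<close>)
  qed (auto intro!: always_eventually less_trans[OF _ tail_pos])
qed

end

section \<open>The regime in which \<open>x n / a n\<close> tends to infinity\<close>

locale large_deviation = heavy_tailed_sums M X D \<alpha> p a b
  for M :: "'a measure" and X and D and \<alpha> p a b +
  fixes x :: "nat \<Rightarrow> real"
  assumes x_large: "filterlim (\<lambda>n. x n / a n) at_top sequentially"
begin

lemma x_ge: "eventually (\<lambda>n. x n \<ge> K * a n) sequentially"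
proof -
  have "eventually (\<lambda>n. x n / a n \<ge> K) sequentially"
    using x_large by (auto simp: filterlim_at_top)
  then show ?thesis using a_pos by eventually_elim (simp add: field_simps)
qed

lemma x_lim: "filterlim x at_top sequentially"
  by (rule filterlim_at_top_mono[OF a_lim]) (use x_ge[of 1] in simp)

lemma scaled_x_lim: "c > 0 \<Longrightarrow> filterlim (\<lambda>n. c * x n) at_top sequentially"
  by (rule filterlim_compose[OF filterlim_scale x_lim])

lemma x_pos: "eventually (\<lambda>n. x n > 0) sequentially"
  using x_lim by (auto simp: filterlim_at_top_dense)

text \<open>For each fixed \<open>K\<close>, eventually \<open>c * x n \<ge> K * a n\<close>, so the
  limit superior is at most \<open>K powr (- \<alpha>)\<close>, which is arbitrarily small.
  Monotonicity of the tail replaces any uniformity in regular variation.\<close>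

lemma two_sided_tail_at_x:
  assumes c: "c > 0"
  shows "(\<lambda>n. real n * two_sided_tail D (c * x n)) \<longlonglongrightarrow> 0"
proof (rule order_tendstoI)
  fix e :: real assume e: "e > 0"
  have "((\<lambda>K. K powr (- \<alpha>)) \<longlongrightarrow> 0) at_top" using \<alpha> by (intro tendsto_neg_powr filterlim_ident) auto
  from order_tendstoD(2)[OF this e] have "eventually (\<lambda>K. K > 0 \<and> K powr (- \<alpha>) < e) at_top"
    using eventually_gt_at_top[of 0] by eventually_elim auto
  then obtain K where K: "K > 0" "K powr (- \<alpha>) < e"
    using eventually_happens'[OF trivial_limit_at_top_linorder] by blast
  from order_tendstoD(2)[OF two_sided_tail_at_a[OF K(1)] K(2)]
  show "eventually (\<lambda>n. real n * two_sided_tail D (c * x n) < e) sequentially"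
    using x_ge[of "K / c"]
  proof eventually_elim
    fix n assume *: "real n * two_sided_tail D (K * a n) < e" "K / c * a n \<le> x n"
    then have "K * a n \<le> c * x n" using c by (simp add: field_simps)
    from mult_left_mono[OF D.two_sided_tail_antimono[OF this], of "real n"] *
    show "real n * two_sided_tail D (c * x n) < e" by simp
  qed
next
  fix e :: real assume "e < 0"
  then show "eventually (\<lambda>n. e < real n * two_sided_tail D (c * x n)) sequentially"
    using tail_pos by (intro always_eventually allI) (meson less_eq_real_def less_le_trans mult_nonneg_nonneg of_nat_0_le_iff)
qed

lemma deviation_antimono: "r \<le> s \<Longrightarrow> deviation n c s \<le> deviation n c r"
  unfolding deviation_def by (intro finite_measure_mono) auto

lemma deviation_nonneg: "0 \<le> deviation n c r"
  by (simp add: deviation_def)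

lemma deviation_at_x:
  assumes c: "c > 0"
  shows "(\<lambda>n. deviation n (b n) (c * x n)) \<longlonglongrightarrow> 0"
proof (rule order_tendstoI)
  fix e :: real assume e: "e > 0"
  obtain K where K: "K > 0" "eventually (\<lambda>n. deviation n (b n) (K * a n) \<le> e / 2) sequentially"
    using tight[of "e / 2"] e by auto
  from K(2) show "eventually (\<lambda>n. deviation n (b n) (c * x n) < e) sequentially"
    using x_ge[of "K / c"]
  proof eventually_elim
    fix n assume *: "deviation n (b n) (K * a n) \<le> e / 2" "K / c * a n \<le> x n"
    then have "K * a n \<le> c * x n" using c by (simp add: field_simps)
    from deviation_antimono[OF this, of n "b n"] * e
    show "deviation n (b n) (c * x n) < e" by simp
  qed
qed (auto intro!: always_eventually less_le_trans[OF _ deviation_nonneg])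

lemma right_tail_ratio_at_x:
  assumes c: "c > 0"
  shows "(\<lambda>n. (real n * right_tail D (c * x n)) / (real n * right_tail D (x n))) \<longlonglongrightarrow> c powr (- \<alpha>)"
proof (rule Lim_transform_eventually)
  show "(\<lambda>n. right_tail D (c * x n) / right_tail D (x n)) \<longlonglongrightarrow> c powr (- \<alpha>)"
    by (rule filterlim_compose[OF right_tail_regular[OF c] x_lim])
qed (use eventually_gt_at_top[of 0] in \<open>eventually_elim; simp\<close>)

lemma right_tail_at_x:
  assumes c: "c > 0"
  shows "(\<lambda>n. real n * right_tail D (c * x n)) \<longlonglongrightarrow> 0"
  by (rule tendsto_sandwich[OF _ _ tendsto_const two_sided_tail_at_x[OF c]])
    (auto intro!: always_eventually mult_left_mono D.right_tail_le_two_sided simp: D.right_tail_nonneg)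

lemma noise_at_x:
  assumes c: "c > 0"
  shows "(\<lambda>n. deviation n (b n) (c * x n) + two_sided_tail D (c * x n)) \<longlonglongrightarrow> 0"
  using tendsto_add[OF deviation_at_x[OF c] filterlim_compose[OF two_sided_tail_lim scaled_x_lim[OF c]]]
  by simp

abbreviation "prob_sum n \<equiv> prob {\<omega> \<in> space M. partial_sum X n \<omega> - b n \<ge> x n}"
abbreviation "prob_max n \<equiv> prob {\<omega> \<in> space M. partial_max X n \<omega> \<ge> x n}"
abbreviation "prob_both n \<equiv> prob {\<omega> \<in> space M. partial_sum X n \<omega> - b n \<ge> x n \<and> partial_max X n \<omega> \<ge> x n}"
abbreviation "tail_n n \<equiv> real n * right_tail D (x n)"

lemma tail_n_pos: "n \<ge> 1 \<Longrightarrow> tail_n n > 0"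
  using right_tail_pos by simp

lemma prob_both_lower:
  assumes \<epsilon>: "\<epsilon> > 0"
  shows "eventually (\<lambda>n. prob_both n / tail_n n > 1 - \<epsilon>) sequentially"
proof -
  have "((\<lambda>e. (1 + e) powr (- \<alpha>)) \<longlongrightarrow> (1 + 0) powr (- \<alpha>)) (at_right 0)"
    by (intro tendsto_intros) auto
  then have "eventually (\<lambda>e. 1 - \<epsilon> < (1 + e) powr (- \<alpha>)) (at_right 0)"
    by (rule order_tendstoD(1)) (use \<epsilon> in simp)
  then have "eventually (\<lambda>e. 0 < e \<and> 1 - \<epsilon> < (1 + e) powr (- \<alpha>)) (at_right 0)"
    using eventually_at_right_less[of 0] by eventually_elim auto
  then obtain e where e: "0 < e" "1 - \<epsilon> < (1 + e) powr (- \<alpha>)"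
    using eventually_happens'[OF trivial_limit_at_right_real] by blast
  let ?W = "\<lambda>n. real n * right_tail D ((1 + e) * x n)"
  let ?N = "\<lambda>n. deviation n (b n) (e / 2 * x n) + two_sided_tail D (e / 2 * x n)"
  \<comment> \<open>The bound of \<open>one_big_jump_lower\<close> for
    \<open>u = (1 + e) * x n\<close> and \<open>v = e * x n\<close>, so that
    \<open>u - v = x n\<close>, divided by \<open>tail_n n\<close>. The quadratic term keeps a
    factor \<open>?W n\<close> that tends to 0.\<close>
  have "(\<lambda>n. ?W n / tail_n n * (1 - ?N n) - ?W n / tail_n n * ?W n)
      \<longlonglongrightarrow> (1 + e) powr (- \<alpha>) * (1 - 0) - (1 + e) powr (- \<alpha>) * 0"
    using e by (intro tendsto_intros right_tail_ratio_at_x right_tail_at_x noise_at_x) auto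
  then have "eventually (\<lambda>n. 1 - \<epsilon> < ?W n / tail_n n * (1 - ?N n) - ?W n / tail_n n * ?W n) sequentially"
    by (rule order_tendstoD(1)) (use e in simp)
  then show ?thesis
    using eventually_ge_at_top[of 2] x_pos
  proof eventually_elim
    fix n assume n: "1 - \<epsilon> < ?W n / tail_n n * (1 - ?N n) - ?W n / tail_n n * ?W n" "2 \<le> n" "0 < x n"
    have "?W n * (1 - ?N n) - (?W n)\<^sup>2
      \<le> prob {\<omega> \<in> space M. partial_sum X n \<omega> - b n \<ge> (1 + e) * x n - e * x n \<and> partial_max X n \<omega> \<ge> (1 + e) * x n}"
      using one_big_jump_lower[OF n(2), of "(1 + e) * x n" "b n" "e * x n"] by (simp add: algebra_simps)
    also have "\<dots> \<le> prob_both n"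
    proof (rule finite_measure_mono, safe)
      fix \<omega> assume \<omega>: "(1 + e) * x n - e * x n \<le> partial_sum X n \<omega> - b n" "(1 + e) * x n \<le> partial_max X n \<omega>"
      have "(1 + e) * x n = x n + e * x n" "0 < e * x n" using n e by (simp_all add: algebra_simps)
      then show "x n \<le> partial_sum X n \<omega> - b n" "x n \<le> partial_max X n \<omega>" using \<omega> by linarith+
    qed measurable
    finally have "(?W n * (1 - ?N n) - (?W n)\<^sup>2) / tail_n n \<le> prob_both n / tail_n n"
      using D.right_tail_nonneg by (intro divide_right_mono) auto
    moreover have "(?W n * (1 - ?N n) - (?W n)\<^sup>2) / tail_n n = ?W n / tail_n n * (1 - ?N n) - ?W n / tail_n n * ?W n"
      by (simp add: diff_divide_distrib power2_eq_square)
    ultimately show "1 - \<epsilon> < prob_both n / tail_n n" using n(1) by linarith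
  qed
qed

lemma prob_both_le_max: "prob_both n \<le> prob_max n"
  by (rule finite_measure_mono) auto

lemma prob_both_le_sum: "prob_both n \<le> prob_sum n"
  by (rule finite_measure_mono) auto

lemma prob_max_le: "n \<ge> 1 \<Longrightarrow> prob_max n \<le> tail_n n"
  by (rule prob_partial_max_ge_le)

lemma prob_sum_upper:
  assumes \<epsilon>: "\<epsilon> > 0"
  shows "eventually (\<lambda>n. prob_sum n / tail_n n < 1 + \<epsilon>) sequentially"
proof -
  obtain C T where C: "C > 0" and T: "T > 0"
    "\<And>t. t \<ge> T \<Longrightarrow> truncated_moment D t \<le> C * t\<^sup>2 * two_sided_tail D t"
    using D.truncated_moment_bound[OF tail_regular[of 2] tail_pos \<alpha>(2)] by auto
  \<comment> \<open>This is the limit in \<open>n\<close> of the upper bound for fixed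
    \<open>e\<close>. As \<open>e\<close> decreases to 0 the Chebyshev contribution disappears,
    because \<open>2 - \<alpha>\<close> is positive.\<close>
  have "((\<lambda>e. (1 - e) powr (- \<alpha>) + 4 * C / p * e powr (2 - \<alpha>)) \<longlongrightarrow>
      (1 - 0) powr (- \<alpha>) + 4 * C / p * 0 powr (2 - \<alpha>)) (at_right 0)"
    using \<alpha> by (intro tendsto_add tendsto_mult tendsto_powr' tendsto_intros)
      (auto intro!: eventually_mono[OF eventually_at_right_less])
  then have "eventually (\<lambda>e. (1 - e) powr (- \<alpha>) + 4 * C / p * e powr (2 - \<alpha>) < 1 + \<epsilon>) (at_right 0)"
    by (rule order_tendstoD(2)) (use \<epsilon> in simp)
  moreover have "eventually (\<lambda>e::real. e \<in> {0<..<1}) (at_right 0)"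
    by (rule eventually_at_right_real) simp
  ultimately have "eventually (\<lambda>e. 0 < e \<and> e < 1 \<and> (1 - e) powr (- \<alpha>) + 4 * C / p * e powr (2 - \<alpha>) < 1 + \<epsilon>) (at_right 0)"
    by eventually_elim auto
  then obtain e where e: "0 < e" "e < 1" "(1 - e) powr (- \<alpha>) + 4 * C / p * e powr (2 - \<alpha>) < 1 + \<epsilon>"
    using eventually_happens'[OF trivial_limit_at_right_real] by blast
  let ?W = "\<lambda>n. real n * right_tail D ((1 - e) * x n)"
  let ?V = "\<lambda>n. real n * right_tail D (e * x n)"
  let ?H = "\<lambda>n. real n * two_sided_tail D (e * x n)"
  let ?N = "\<lambda>n. deviation n (b n) (e / 2 * x n) + two_sided_tail D (e / 2 * x n)"
  have moment: "eventually (\<lambda>n. real n * truncated_moment D (e * x n) \<le> C * e\<^sup>2 * (x n)\<^sup>2 * ?H n) sequentially"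
    using scaled_x_lim[OF e(1), unfolded filterlim_at_top, rule_format, of T]
  proof eventually_elim
    fix n assume "T \<le> e * x n"
    from mult_left_mono[OF T(2)[OF this], of "real n"]
    show "real n * truncated_moment D (e * x n) \<le> C * e\<^sup>2 * (x n)\<^sup>2 * ?H n"
      by (simp add: power_mult_distrib mult_ac)
  qed
  have mean: "eventually (\<lambda>n. \<bar>real n * (\<integral>y. truncate (e * x n) y \<partial>D) - b n\<bar> \<le> x n / 2) sequentially"
  proof -
    \<comment> \<open>The condition of \<open>truncated_mean_close\<close> with
      \<open>r = x n / 2\<close>: the factor 4 becomes 16, and the deviation is taken at
      \<open>x n / 4\<close>.\<close>
    have "(\<lambda>n. 16 * C * e\<^sup>2 * ?H n + ?H n + deviation n (b n) (1 / 4 * x n)) \<longlonglongrightarrow> 16 * C * e\<^sup>2 * 0 + 0 + 0"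
      using e by (intro tendsto_intros two_sided_tail_at_x deviation_at_x) auto
    then have "eventually (\<lambda>n. 16 * C * e\<^sup>2 * ?H n + ?H n + deviation n (b n) (1 / 4 * x n) < 1) sequentially"
      by (rule order_tendstoD(2)) simp
    then show ?thesis using moment x_pos
    proof eventually_elim
      fix n assume n: "16 * C * e\<^sup>2 * ?H n + ?H n + deviation n (b n) (1 / 4 * x n) < 1"
        "real n * truncated_moment D (e * x n) \<le> C * e\<^sup>2 * (x n)\<^sup>2 * ?H n" "x n > 0"
      have "4 * real n * truncated_moment D (e * x n) / (x n / 2)\<^sup>2
          = 16 * (real n * truncated_moment D (e * x n)) / (x n)\<^sup>2" by (simp add: power_divide)
      also have "\<dots> \<le> 16 * (C * e\<^sup>2 * (x n)\<^sup>2 * ?H n) / (x n)\<^sup>2"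
        using n(2) by (intro divide_right_mono mult_left_mono) auto
      also have "\<dots> = 16 * C * e\<^sup>2 * ?H n" using n(3) by simp
      finally show "\<bar>real n * (\<integral>y. truncate (e * x n) y \<partial>D) - b n\<bar> \<le> x n / 2"
        using n e by (intro truncated_mean_close) auto
    qed
  qed
  \<comment> \<open>Chebyshev yields a two-sided tail, which must be compared with the right tail;
    here \<open>p > 0\<close> is essential.\<close>
  have Hr: "(\<lambda>n. ?H n / ?V n) \<longlonglongrightarrow> 1 / p"
  proof (rule Lim_transform_eventually)
    show "(\<lambda>n. 1 / (right_tail D (e * x n) / two_sided_tail D (e * x n))) \<longlonglongrightarrow> 1 / p"
      using p by (intro tendsto_intros filterlim_compose[OF tail_balance scaled_x_lim[OF e(1)]]) auto
  qed (use eventually_gt_at_top[of 0] in \<open>eventually_elim; simp\<close>)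
  have "(\<lambda>n. ?W n / tail_n n + ?V n / tail_n n * ?N n + 4 * C * e\<^sup>2 * (?H n / ?V n * (?V n / tail_n n)))
     \<longlonglongrightarrow> (1 - e) powr (- \<alpha>) + e powr (- \<alpha>) * 0 + 4 * C * e\<^sup>2 * (1 / p * e powr (- \<alpha>))"
    using e by (intro tendsto_intros right_tail_ratio_at_x Hr noise_at_x) auto
  moreover have "e\<^sup>2 * e powr (- \<alpha>) = e powr (2 - \<alpha>)"
    using e by (simp add: powr_diff powr_minus field_simps)
  ultimately have "(\<lambda>n. ?W n / tail_n n + ?V n / tail_n n * ?N n + 4 * C * e\<^sup>2 * (?H n / ?V n * (?V n / tail_n n)))
     \<longlonglongrightarrow> (1 - e) powr (- \<alpha>) + 4 * C / p * e powr (2 - \<alpha>)" by (simp add: mult_ac)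
  from order_tendstoD(2)[OF this e(3)] show ?thesis
    using moment mean x_pos eventually_ge_at_top[of 2]
  proof eventually_elim
    fix n assume n: "?W n / tail_n n + ?V n / tail_n n * ?N n + 4 * C * e\<^sup>2 * (?H n / ?V n * (?V n / tail_n n)) < 1 + \<epsilon>"
      "real n * truncated_moment D (e * x n) \<le> C * e\<^sup>2 * (x n)\<^sup>2 * ?H n"
      "\<bar>real n * (\<integral>y. truncate (e * x n) y \<partial>D) - b n\<bar> \<le> x n / 2" "x n > 0" "2 \<le> n"
    have V: "?V n > 0" "tail_n n > 0" using right_tail_pos n(5) by auto
    \<comment> \<open>Both the threshold \<open>z\<close> and the slack \<open>r\<close> are taken
      to be \<open>e * x n\<close>.\<close>
    have "prob_sum n \<le> real n * right_tail D (x n - e * x n)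
      + real n * (right_tail D (e * x n) * (deviation n (b n) (e * x n / 2) + two_sided_tail D (e * x n / 2)))
      + 4 * real n * truncated_moment D (e * x n) / (x n)\<^sup>2"
      using n e by (intro one_big_jump_upper) auto
    also have "4 * real n * truncated_moment D (e * x n) / (x n)\<^sup>2 \<le> 4 * (C * e\<^sup>2 * (x n)\<^sup>2 * ?H n) / (x n)\<^sup>2"
      unfolding mult.assoc[of 4] using n(2) by (intro divide_right_mono mult_left_mono) auto
    also have "\<dots> = 4 * C * e\<^sup>2 * ?H n" using n(4) by simp
    finally have "prob_sum n \<le> ?W n + ?V n * ?N n + 4 * C * e\<^sup>2 * ?H n"
      by (simp add: algebra_simps)
    then have "prob_sum n / tail_n n \<le> (?W n + ?V n * ?N n + 4 * C * e\<^sup>2 * ?H n) / tail_n n"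
      using V by (intro divide_right_mono) auto
    also have "\<dots> = ?W n / tail_n n + ?V n / tail_n n * ?N n + 4 * C * e\<^sup>2 * (?H n / ?V n * (?V n / tail_n n))"
      using right_tail_pos[of "e * x n"] n(5) by (simp add: add_divide_distrib)
    finally show "prob_sum n / tail_n n < 1 + \<epsilon>" using n(1) by simp
  qed
qed

section \<open>Asymptotic equivalence of the three probabilities with \<open>tail_n\<close>\<close>

lemma prob_both_equiv: "(\<lambda>n. prob_both n / tail_n n) \<longlonglongrightarrow> 1"
proof (rule tendsto_1I)
  fix \<epsilon> :: real assume "\<epsilon> > 0"
  show "eventually (\<lambda>n. prob_both n / tail_n n < 1 + \<epsilon>) sequentially"
    using eventually_ge_at_top[of 1]
  proof eventually_elim
    fix n :: nat assume "1 \<le> n"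
    then have "prob_both n / tail_n n \<le> 1" using prob_both_le_max[of n] prob_max_le[of n] tail_n_pos[of n] by simp
    then show "prob_both n / tail_n n < 1 + \<epsilon>" using \<open>\<epsilon> > 0\<close> by simp
  qed
qed (rule prob_both_lower)

lemma prob_max_equiv: "(\<lambda>n. prob_max n / tail_n n) \<longlonglongrightarrow> 1"
proof (rule tendsto_sandwich[OF _ _ prob_both_equiv tendsto_const])
  show "eventually (\<lambda>n. prob_both n / tail_n n \<le> prob_max n / tail_n n) sequentially"
    using D.right_tail_nonneg by (intro always_eventually allI divide_right_mono prob_both_le_max) auto
  show "eventually (\<lambda>n. prob_max n / tail_n n \<le> 1) sequentially"
    using eventually_ge_at_top[of 1] by eventually_elim (use prob_max_le tail_n_pos in auto)
qed

text \<open>The lower bound is inherited from the joint event. The upper bound is the substantial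
  half, since a large sum does not force a large maximum.\<close>

lemma prob_sum_equiv: "(\<lambda>n. prob_sum n / tail_n n) \<longlonglongrightarrow> 1"
proof (rule tendsto_1I)
  fix \<epsilon> :: real assume "\<epsilon> > 0"
  from prob_both_lower[OF this] show "eventually (\<lambda>n. prob_sum n / tail_n n > 1 - \<epsilon>) sequentially"
  proof eventually_elim
    fix n assume "1 - \<epsilon> < prob_both n / tail_n n"
    also have "\<dots> \<le> prob_sum n / tail_n n"
      using D.right_tail_nonneg by (intro divide_right_mono prob_both_le_sum) auto
    finally show "1 - \<epsilon> < prob_sum n / tail_n n" .
  qed
qed (rule prob_sum_upper)

text \<open>Guarantees that the conditional laws are eventually genuine probability
  measures.\<close>

lemma prob_sum_pos: "eventually (\<lambda>n. prob_sum n > 0) sequentially"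
proof -
  have "eventually (\<lambda>n. 0 < prob_sum n / tail_n n) sequentially"
    by (rule order_tendstoD(1)[OF prob_sum_equiv]) simp
  then show ?thesis
    by eventually_elim (use D.right_tail_nonneg in \<open>auto simp: zero_less_divide_iff intro: less_le_trans\<close>)
qed

end


section \<open>Total variation and weak convergence of the remaining coordinates\<close>

lemma tv_dist_le:
  assumes "\<And>A. A \<in> sets P \<Longrightarrow> \<bar>measure P A - measure Q A\<bar> \<le> e"
  shows "tv_dist P Q \<le> e"
  unfolding tv_dist_def using sets.empty_sets assms by (intro cSUP_least) blast+

text \<open>For probability measures the differences are bounded by 1, so the real supremum is a
  true upper bound.\<close>

lemma tv_dist_ge:
  assumes "prob_space P" "prob_space Q" "A \<in> sets P"
  shows "\<bar>measure P A - measure Q A\<bar> \<le> tv_dist P Q"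
  unfolding tv_dist_def
proof (rule cSUP_upper[OF assms(3) bdd_aboveI2])
  fix B
  show "\<bar>measure P B - measure Q B\<bar> \<le> 1"
    using prob_space.prob_le_1[OF assms(1), of B] prob_space.prob_le_1[OF assms(2), of B]
      measure_nonneg[of P B] measure_nonneg[of Q B] by linarith
qed

lemma (in prob_space) prob_space_cond_law:
  assumes "prob E > 0" "f \<in> measurable M N"
  shows "prob_space (cond_law M E N f)"
proof -
  have "prob_space (uniform_measure M E)"
    using assms(1) by (intro prob_space_uniform_measure) (auto simp: emeasure_eq_measure)
  then show ?thesis unfolding cond_law_def using assms(2) by (intro prob_space.prob_space_distr) auto
qed

context large_deviation
begin

abbreviation "sum_event n \<equiv> {\<omega> \<in> space M. partial_sum X n \<omega> - b n \<ge> x n}"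
abbreviation "rest_law n \<equiv>
  cond_law M (sum_event n) (Pi\<^sub>M {..<n - 1} (\<lambda>_. borel)) (\<lambda>\<omega>. delete_max n (\<lambda>i. X i \<omega>))"

definition "tv_bound n = \<bar>tail_n n / prob_sum n - 1\<bar> + (1 - prob_both n / prob_sum n)"

lemma tv_bound_lim: "tv_bound \<longlonglongrightarrow> 0"
proof -
  have "(\<lambda>n. \<bar>1 / (prob_sum n / tail_n n) - 1\<bar> + (1 - (prob_both n / tail_n n) / (prob_sum n / tail_n n)))
     \<longlonglongrightarrow> \<bar>1 / 1 - 1\<bar> + (1 - 1 / 1)"
    by (intro tendsto_intros prob_sum_equiv prob_both_equiv) auto
  then have "tv_bound \<longlonglongrightarrow> \<bar>1 / 1 - 1\<bar> + (1 - 1 / 1)"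
  proof (rule Lim_transform_eventually)
    show "eventually (\<lambda>n. \<bar>1 / (prob_sum n / tail_n n) - 1\<bar> + (1 - (prob_both n / tail_n n) / (prob_sum n / tail_n n)) = tv_bound n) sequentially"
      using eventually_ge_at_top[of 1]
    proof eventually_elim
      fix n :: nat assume "1 \<le> n"
      then have "tail_n n \<noteq> 0" using right_tail_pos[of "x n"] by simp
      then show "\<bar>1 / (prob_sum n / tail_n n) - 1\<bar> + (1 - (prob_both n / tail_n n) / (prob_sum n / tail_n n)) = tv_bound n"
        unfolding tv_bound_def by simp
    qed
  qed
  then show ?thesis by simp
qed

lemma rest_law_close:
  assumes "n \<ge> 2" "prob_sum n > 0" "A \<in> sets (Pi\<^sub>M {..<n - 1} (\<lambda>_. borel))"
  shows "\<bar>measure (rest_law n) A - measure (Pi\<^sub>M {..<n - 1} (\<lambda>_. D)) A\<bar> \<le> tv_bound n"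
  unfolding tv_bound_def by (rule cond_law_delete_max_close[OF assms(1,3,2)])

lemma tv_dist_rest_law_lim: "(\<lambda>n. tv_dist (rest_law n) (Pi\<^sub>M {..<n - 1} (\<lambda>_. D))) \<longlonglongrightarrow> 0"
proof (rule tendsto_sandwich[OF _ _ tendsto_const tv_bound_lim])
  show "eventually (\<lambda>n. tv_dist (rest_law n) (Pi\<^sub>M {..<n - 1} (\<lambda>_. D)) \<le> tv_bound n) sequentially"
    using prob_sum_pos eventually_ge_at_top[of 2]
    by eventually_elim (intro tv_dist_le rest_law_close, auto)
  \<comment> \<open>Nonnegativity is read off at the empty set, once the conditioning event has
    positive probability.\<close>
  show "eventually (\<lambda>n. 0 \<le> tv_dist (rest_law n) (Pi\<^sub>M {..<n - 1} (\<lambda>_. D))) sequentially"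
    using prob_sum_pos
  proof eventually_elim
    fix n assume "prob_sum n > 0"
    from tv_dist_ge[OF prob_space_cond_law[OF this delete_max_measurable] prob_space_PiM_D sets.empty_sets]
    show "0 \<le> tv_dist (rest_law n) (Pi\<^sub>M {..<n - 1} (\<lambda>_. D))" by simp
  qed
qed

end

section \<open>Weak limits under small perturbations\<close>

lemma (in real_distribution) cdf_continuity_point_between:
  assumes "s < t"
  obtains u where "s < u" "u < t" "isCont (cdf M) u"
proof -
  have "countable {u. \<not> isCont (cdf M) u}"
    by (rule countable_subset[OF _ countable_atoms]) (auto simp: isCont_cdf zero_less_measure_iff)
  moreover have "uncountable {s<..<t}" using assms by (simp add: uncountable_open_interval)
  ultimately have "\<not> {s<..<t} \<subseteq> {u. \<not> isCont (cdf M) u}" using countable_subset by blast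
  then show ?thesis using that by auto
qed

text \<open>A Slutsky-type sandwich. Since \<open>t - e\<close> and \<open>t + e\<close> may be
  discontinuities, a continuity point \<open>u\<close> close to \<open>t\<close> is chosen first and
  \<open>e\<close> is its distance from \<open>t\<close>.\<close>

lemma (in real_distribution) cdf_limit_perturbed:
  fixes F :: "nat \<Rightarrow> real \<Rightarrow> real"
  assumes F: "\<And>s. isCont (cdf M) s \<Longrightarrow> (\<lambda>n. F n s) \<longlonglongrightarrow> cdf M s"
    and t: "isCont (cdf M) t"
    and r: "\<And>e. e > 0 \<Longrightarrow> r e \<longlonglongrightarrow> 0"
    and low: "\<And>e. e > 0 \<Longrightarrow> eventually (\<lambda>n. F n (t - e) - r e n \<le> G n) sequentially"
    and up: "\<And>e. e > 0 \<Longrightarrow> eventually (\<lambda>n. G n \<le> F n (t + e) + r e n) sequentially"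
  shows "G \<longlonglongrightarrow> cdf M t"
proof (rule order_tendstoI)
  fix y assume y: "y < cdf M t"
  from order_tendstoD(1)[OF t[unfolded isCont_def] y]
  obtain d where d: "d > 0" "\<And>s. s \<noteq> t \<Longrightarrow> dist s t < d \<Longrightarrow> y < cdf M s"
    by (auto simp: eventually_at)
  obtain u where u: "t - d < u" "u < t" "isCont (cdf M) u"
    using cdf_continuity_point_between[of "t - d" t] d by auto
  have "(\<lambda>n. F n u - r (t - u) n) \<longlonglongrightarrow> cdf M u - 0" using u by (intro tendsto_intros F r) auto
  then have "eventually (\<lambda>n. y < F n u - r (t - u) n) sequentially"
    by (rule order_tendstoD(1)) (use d(2)[of u] u in \<open>auto simp: dist_real_def\<close>)
  moreover have "eventually (\<lambda>n. F n u - r (t - u) n \<le> G n) sequentially"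
    using low[of "t - u"] u by simp
  ultimately show "eventually (\<lambda>n. y < G n) sequentially"
    by eventually_elim simp
next
  fix y assume y: "cdf M t < y"
  from order_tendstoD(2)[OF t[unfolded isCont_def] y]
  obtain d where d: "d > 0" "\<And>s. s \<noteq> t \<Longrightarrow> dist s t < d \<Longrightarrow> cdf M s < y"
    by (auto simp: eventually_at)
  obtain u where u: "t < u" "u < t + d" "isCont (cdf M) u"
    using cdf_continuity_point_between[of t "t + d"] d by auto
  have "(\<lambda>n. F n u + r (u - t) n) \<longlonglongrightarrow> cdf M u + 0" using u by (intro tendsto_intros F r) auto
  then have "eventually (\<lambda>n. F n u + r (u - t) n < y) sequentially"
    by (rule order_tendstoD(2)) (use d(2)[of u] u in \<open>auto simp: dist_real_def\<close>)
  moreover have "eventually (\<lambda>n. G n \<le> F n u + r (u - t) n) sequentially"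
    using up[of "u - t"] u by simp
  ultimately show "eventually (\<lambda>n. G n < y) sequentially"
    by eventually_elim simp
qed

context large_deviation
begin

text \<open>Omitting \<open>X 0\<close> from the sum does not change the weak limit, because one
  summand is negligible against \<open>a n\<close>. The sum without its maximum is a function of the
  remaining vector, so its conditional distribution function differs from that of the sum without
  \<open>X 0\<close> by at most \<open>tv_bound n\<close>.\<close>

lemma cond_law_without_max_weak_conv:
  assumes S: "real_distribution S"
    and conv: "weak_conv_m (\<lambda>n. distr M borel (\<lambda>\<omega>. (partial_sum X n \<omega> - b n) / a n)) S"
  shows "weak_conv_m
    (\<lambda>n. cond_law M (sum_event n) borel (\<lambda>\<omega>. (partial_sum X n \<omega> - b n - partial_max X n \<omega>) / a n)) S"
  unfolding weak_conv_m_def weak_conv_def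
proof (intro allI impI)
  interpret S: real_distribution S by fact
  fix t assume t: "isCont (cdf S) t"
  let ?L = "\<lambda>n. cond_law M (sum_event n) borel (\<lambda>\<omega>. (partial_sum X n \<omega> - b n - partial_max X n \<omega>) / a n)"
  define F where "F n s = prob {\<omega> \<in> space M. (partial_sum X n \<omega> - b n) / a n \<le> s}" for n s
  \<comment> \<open>Only \<open>n - 1\<close> summands remain, but centering and scaling keep the
    index \<open>n\<close>; thus \<open>b (n - 1)\<close> and \<open>b n\<close> are never
    compared.\<close>
  define G where "G n = prob {\<omega> \<in> space M. (partial_sum X n \<omega> - X 0 \<omega> - b n) / a n \<le> t}" for n
  have "cdf (distr M borel (\<lambda>\<omega>. (partial_sum X n \<omega> - b n) / a n)) s = F n s" for n s
    unfolding cdf_def F_def by (subst measure_distr) (auto intro!: arg_cong[where f=prob])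
  then have F: "(\<lambda>n. F n s) \<longlonglongrightarrow> cdf S s" if "isCont (cdf S) s" for s
    using conv that unfolding weak_conv_m_def weak_conv_def by auto
  define r where "r e n = two_sided_tail D (e * a n)" for e n
  have G: "G \<longlonglongrightarrow> cdf S t"
  proof (rule S.cdf_limit_perturbed[OF F t, of r])
    fix e :: real assume e: "e > 0"
    show "r e \<longlonglongrightarrow> 0"
      unfolding r_def[abs_def] by (rule filterlim_compose[OF two_sided_tail_lim filterlim_compose[OF filterlim_scale[OF e] a_lim]])
    show "eventually (\<lambda>n. F n (t - e) - r e n \<le> G n) sequentially"
      using a_pos
    proof eventually_elim
      fix n assume n: "a n > 0"
      have "F n (t - e) \<le> prob ({\<omega> \<in> space M. (partial_sum X n \<omega> - X 0 \<omega> - b n) / a n \<le> t} \<union> {\<omega> \<in> space M. \<bar>X 0 \<omega>\<bar> \<ge> e * a n})"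
        unfolding F_def
      proof (rule finite_measure_mono, safe)
        fix \<omega> assume "(partial_sum X n \<omega> - b n) / a n \<le> t - e" "\<not> e * a n \<le> \<bar>X 0 \<omega>\<bar>"
        then have "partial_sum X n \<omega> - b n \<le> (t - e) * a n" "- X 0 \<omega> \<le> e * a n" using n by (auto simp: field_simps)
        then have "partial_sum X n \<omega> - X 0 \<omega> - b n \<le> t * a n" by (simp add: algebra_simps)
        then show "(partial_sum X n \<omega> - X 0 \<omega> - b n) / a n \<le> t" using n by (simp add: field_simps)
      qed measurable
      also have "\<dots> \<le> G n + prob {\<omega> \<in> space M. \<bar>X 0 \<omega>\<bar> \<ge> e * a n}"
        unfolding G_def by (rule measure_Un_le) measurable
      finally show "F n (t - e) - r e n \<le> G n" by (simp add: prob_abs_X_ge r_def)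
    qed
    show "eventually (\<lambda>n. G n \<le> F n (t + e) + r e n) sequentially"
      using a_pos
    proof eventually_elim
      fix n assume n: "a n > 0"
      have "G n \<le> prob ({\<omega> \<in> space M. (partial_sum X n \<omega> - b n) / a n \<le> t + e} \<union> {\<omega> \<in> space M. \<bar>X 0 \<omega>\<bar> \<ge> e * a n})"
        unfolding G_def
      proof (rule finite_measure_mono, safe)
        fix \<omega> assume "(partial_sum X n \<omega> - X 0 \<omega> - b n) / a n \<le> t" "\<not> e * a n \<le> \<bar>X 0 \<omega>\<bar>"
        then have "partial_sum X n \<omega> - X 0 \<omega> - b n \<le> t * a n" "X 0 \<omega> \<le> e * a n" using n by (auto simp: field_simps)
        then have "partial_sum X n \<omega> - b n \<le> (t + e) * a n" by (simp add: algebra_simps)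
        then show "(partial_sum X n \<omega> - b n) / a n \<le> t + e" using n by (simp add: field_simps)
      qed measurable
      also have "\<dots> \<le> F n (t + e) + prob {\<omega> \<in> space M. \<bar>X 0 \<omega>\<bar> \<ge> e * a n}"
        unfolding F_def by (rule measure_Un_le) measurable
      finally show "G n \<le> F n (t + e) + r e n" by (simp add: prob_abs_X_ge r_def)
    qed
  qed
  have "(\<lambda>n. cdf (?L n) t - G n) \<longlonglongrightarrow> 0"
  proof (rule Lim_null_comparison[OF _ tv_bound_lim])
    show "eventually (\<lambda>n. norm (cdf (?L n) t - G n) \<le> tv_bound n) sequentially"
      using prob_sum_pos eventually_ge_at_top[of 2]
    proof eventually_elim
      fix n assume n: "0 < prob_sum n" "2 \<le> n"
      let ?P = "Pi\<^sub>M {..<n - 1} (\<lambda>_. borel :: real measure)"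
      \<comment> \<open>One set read in two ways: under \<open>delete_max\<close> it describes the
        sum minus the maximum, under the product law the sum minus \<open>X 0\<close>.\<close>
      define A where "A = {y \<in> space ?P. ((\<Sum>j<n - 1. y j) - b n) / a n \<le> t}"
      have A: "A \<in> sets ?P" unfolding A_def by measurable
      have drop: "drop_coord n i (\<lambda>j. X j \<omega>) \<in> A \<longleftrightarrow> (partial_sum X n \<omega> - X i \<omega> - b n) / a n \<le> t" if "i < n" for i \<omega>
        using sum_drop_coord[OF that, of "\<lambda>j. X j \<omega>"]
        by (simp add: A_def partial_sum_def space_PiM) (simp add: drop_coord_def)
      have del: "delete_max n (\<lambda>j. X j \<omega>) \<in> A \<longleftrightarrow> (partial_sum X n \<omega> - b n - partial_max X n \<omega>) / a n \<le> t" for \<omega>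
      proof -
        obtain k where "k < n" "X k \<omega> = Max ((\<lambda>i. X i \<omega>) ` {..<n})"
          "delete_max n (\<lambda>i. X i \<omega>) = drop_coord n k (\<lambda>i. X i \<omega>)"
          using delete_max_argmax[of n "\<lambda>i. X i \<omega>"] n by auto
        then show ?thesis using drop[of k \<omega>] by (simp add: partial_max_def algebra_simps)
      qed
      have E: "sum_event n \<in> events" by measurable
      have "measure (?L n) {..t} = prob {\<omega> \<in> sum_event n. (partial_sum X n \<omega> - b n - partial_max X n \<omega>) / a n \<in> {..t}} / prob_sum n"
        by (rule measure_cond_law[OF E _ _ n(1)]) auto
      then have "cdf (?L n) t = measure (rest_law n) A"
        unfolding cdf_def measure_cond_law[OF E delete_max_measurable A n(1)] del by simp
      moreover have "G n = measure (Pi\<^sub>M {..<n - 1} (\<lambda>_. D)) A"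
        using prob_rest[of 0 n A] n A drop[of 0] by (simp add: G_def)
      ultimately show "norm (cdf (?L n) t - G n) \<le> tv_bound n"
        using rest_law_close[OF n(2,1) A] by simp
    qed
  qed
  from tendsto_add[OF this G] show "(\<lambda>n. cdf (?L n) t) \<longlonglongrightarrow> cdf S t" by simp
qed

end


section \<open>Necessity\<close>

context iid_sequence
begin

lemma prob_two_large_le:
  "prob {\<omega> \<in> space M. \<exists>i<n. \<exists>j<n. i \<noteq> j \<and> X i \<omega> \<ge> t \<and> X j \<omega> \<ge> t} \<le> (real n * right_tail D t)\<^sup>2"
proof -
  have "prob {\<omega> \<in> space M. \<exists>i<n. \<exists>j<n. i \<noteq> j \<and> X i \<omega> \<ge> t \<and> X j \<omega> \<ge> t} \<le> real n * (real n * (right_tail D t)\<^sup>2)"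
  proof (intro prob_exists_le)
    fix i j :: nat
    show "prob {\<omega> \<in> space M. i \<noteq> j \<and> X i \<omega> \<ge> t \<and> X j \<omega> \<ge> t} \<le> (right_tail D t)\<^sup>2"
      using prob_pair[of i j "{t..}" "{t..}"] by (cases "i = j") (auto simp: right_tail_def power2_eq_square)
  qed measurable
  then show ?thesis by (simp add: power2_eq_square mult_ac)
qed

text \<open>The product law is realised on \<open>M\<close> by dropping coordinate 0, which leaves
  \<open>X (Suc j)\<close>; Bonferroni then applies to these variables.\<close>

lemma prob_exists_large_ge:
  assumes n: "n \<ge> 2"
  shows "measure (Pi\<^sub>M {..<n - 1} (\<lambda>_. D)) {y \<in> space (Pi\<^sub>M {..<n - 1} (\<lambda>_. borel)). \<exists>j<n - 1. y j \<ge> t}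
     \<ge> real (n - 1) * right_tail D t - (real (n - 1) * right_tail D t)\<^sup>2"
proof -
  let ?P = "Pi\<^sub>M {..<n - 1} (\<lambda>_. borel :: real measure)"
  let ?A = "{y \<in> space ?P. \<exists>j<n - 1. y j \<ge> t}"
  let ?E = "\<lambda>j. {\<omega> \<in> space M. X (Suc j) \<omega> \<ge> t}"
  have "?A = (\<Union>j\<in>{..<n - 1}. {y \<in> space ?P. y j \<ge> t})" by auto
  also have "\<dots> \<in> sets ?P" by (intro sets.finite_UN) auto
  finally have A: "?A \<in> sets ?P" .
  have "real (card {..<n - 1}) * right_tail D t - (real (card {..<n - 1}))\<^sup>2 * (right_tail D t)\<^sup>2 \<le> prob (\<Union>j\<in>{..<n - 1}. ?E j)"
  proof (rule Bonferroni_lower_bound)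
    fix i j :: nat assume "i \<noteq> j"
    then show "prob (?E i \<inter> ?E j) \<le> (right_tail D t)\<^sup>2"
      using prob_pair[of "Suc i" "Suc j" "{t..}" "{t..}"]
      by (simp add: right_tail_def power2_eq_square Collect_conj_eq[symmetric] Int_def conj_ac cong: conj_cong)
  qed (auto simp: prob_X_ge)
  also have "(\<Union>j\<in>{..<n - 1}. ?E j) = {\<omega> \<in> space M. drop_coord n 0 (\<lambda>j. X j \<omega>) \<in> ?A}"
    by (auto simp: drop_coord_def skip_def space_PiM)
  also have "prob \<dots> = measure (Pi\<^sub>M {..<n - 1} (\<lambda>_. D)) ?A"
    using n by (intro prob_rest A) auto
  finally show ?thesis by (simp add: power_mult_distrib)
qed

text \<open>If a remaining coordinate reaches \<open>t\<close>, so does the deleted maximum, which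
  sits at a different index: two coordinates are large.\<close>

lemma prob_delete_max_large_le:
  assumes n: "n \<ge> 2"
  shows "prob {\<omega> \<in> space M. \<exists>j<n - 1. delete_max n (\<lambda>i. X i \<omega>) j \<ge> t} \<le> (real n * right_tail D t)\<^sup>2"
proof -
  have "prob {\<omega> \<in> space M. \<exists>j<n - 1. delete_max n (\<lambda>i. X i \<omega>) j \<ge> t}
     \<le> prob {\<omega> \<in> space M. \<exists>i<n. \<exists>j<n. i \<noteq> j \<and> X i \<omega> \<ge> t \<and> X j \<omega> \<ge> t}"
  proof (rule finite_measure_mono, safe)
    fix \<omega> j assume j: "j < n - 1" "t \<le> delete_max n (\<lambda>i. X i \<omega>) j"
    obtain k where k: "k < n" "X k \<omega> = Max ((\<lambda>i. X i \<omega>) ` {..<n})"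
      "delete_max n (\<lambda>i. X i \<omega>) = drop_coord n k (\<lambda>i. X i \<omega>)"
      using delete_max_argmax[of n "\<lambda>i. X i \<omega>"] n by auto
    have s: "skip k j < n" "skip k j \<noteq> k" using bij_betw_skip[OF k(1)] j(1) by (auto simp: bij_betw_def)
    have "t \<le> X (skip k j) \<omega>" using j k by (simp add: drop_coord_def)
    moreover have "X (skip k j) \<omega> \<le> X k \<omega>" unfolding k(2) using s by (intro Max_ge) auto
    ultimately show "\<exists>i<n. \<exists>j<n. i \<noteq> j \<and> X i \<omega> \<ge> t \<and> X j \<omega> \<ge> t"
      using s k(1) by (meson order_trans)
  qed measurable
  also note prob_two_large_le
  finally show ?thesis .
qed

end

context heavy_tailed_sums
begin

lemma small_limit_at_a:
  assumes "e > 0"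
  obtains K where "K > K0" "K > 0" "p * K powr (- \<alpha>) < e"
proof -
  have "((\<lambda>K. p * K powr (- \<alpha>)) \<longlongrightarrow> p * 0) at_top"
    using \<alpha> by (intro tendsto_intros tendsto_neg_powr filterlim_ident) auto
  then have "eventually (\<lambda>K. p * K powr (- \<alpha>) < e) at_top"
    by (rule order_tendstoD(2)) (use assms in simp)
  then have "eventually (\<lambda>K. K > K0 \<and> K > 0 \<and> p * K powr (- \<alpha>) < e) at_top"
    using eventually_gt_at_top[of K0] eventually_gt_at_top[of 0] by eventually_elim auto
  then show ?thesis using that eventually_happens'[OF trivial_limit_at_top_linorder] by blast
qed

text \<open>A single jump of order \<open>a n\<close> already has probability bounded away from 0,
  so this works for arbitrarily large \<open>K\<close>.\<close>

lemma prob_sum_bounded_below: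
  obtains \<delta> where "\<delta> > 0"
    "eventually (\<lambda>n. prob {\<omega> \<in> space M. partial_sum X n \<omega> - b n \<ge> K * a n} \<ge> \<delta>) sequentially"
proof -
  obtain v where v: "v > 0" "eventually (\<lambda>n. deviation n (b n) (v * a n) \<le> 1 / 4) sequentially"
    using tight[of "1 / 4"] by auto
  \<comment> \<open>The margin \<open>2 * v\<close> absorbs the fluctuation of the other summands.
    The bound \<open>s < 1 / 2\<close> makes \<open>3 / 4 * s\<close> minus the square of
    \<open>s\<close> exceed \<open>s / 4\<close>, where \<open>3 / 4\<close> is 1 minus the allowed
    deviation.\<close>
  obtain K' where K': "K' > K + 2 * v" "K' > 0" "p * K' powr (- \<alpha>) < 1 / 2"
    using small_limit_at_a[of "1 / 2" "K + 2 * v"] by auto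
  define s where "s = p * K' powr (- \<alpha>)"
  have s: "s > 0" "s < 1 / 2" using p K' by (auto simp: s_def)
  let ?W = "\<lambda>n. real n * right_tail D (K' * a n)"
  have "(\<lambda>n. ?W n * (3 / 4 - two_sided_tail D (v * a n)) - (?W n)\<^sup>2) \<longlonglongrightarrow> s * (3 / 4 - 0) - s\<^sup>2"
    unfolding s_def using K' v
    by (intro tendsto_intros right_tail_at_a filterlim_compose[OF two_sided_tail_lim filterlim_compose[OF filterlim_scale a_lim]])
  moreover have "s / 4 < s * (3 / 4 - 0) - s\<^sup>2"
    using mult_strict_left_mono[OF s(2,1)] by (simp add: power2_eq_square)
  ultimately have "eventually (\<lambda>n. s / 4 < ?W n * (3 / 4 - two_sided_tail D (v * a n)) - (?W n)\<^sup>2) sequentially"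
    by (rule order_tendstoD(1))
  then have "eventually (\<lambda>n. prob {\<omega> \<in> space M. partial_sum X n \<omega> - b n \<ge> K * a n} \<ge> s / 4) sequentially"
    using v(2) a_pos eventually_ge_at_top[of 2]
  proof eventually_elim
    fix n assume n: "s / 4 < ?W n * (3 / 4 - two_sided_tail D (v * a n)) - (?W n)\<^sup>2"
      "deviation n (b n) (v * a n) \<le> 1 / 4" "0 < a n" "2 \<le> n"
    have "?W n * (3 / 4 - two_sided_tail D (v * a n)) \<le> ?W n * (1 - deviation n (b n) (v * a n) - two_sided_tail D (v * a n))"
      using n(2) D.right_tail_nonneg by (intro mult_left_mono) auto
    then have "s / 4 \<le> ?W n * (1 - deviation n (b n) (v * a n) - two_sided_tail D (v * a n)) - (?W n)\<^sup>2"
      using n(1) by linarith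
    also have "\<dots> \<le> prob {\<omega> \<in> space M. partial_sum X n \<omega> - b n \<ge> K' * a n - 2 * (v * a n) \<and> partial_max X n \<omega> \<ge> K' * a n}"
      using one_big_jump_lower[OF n(4), of "K' * a n" "b n" "2 * (v * a n)"] by simp
    also have "\<dots> \<le> prob {\<omega> \<in> space M. partial_sum X n \<omega> - b n \<ge> K * a n}"
    proof (rule finite_measure_mono, safe)
      fix \<omega> assume "K' * a n - 2 * (v * a n) \<le> partial_sum X n \<omega> - b n"
      moreover have "K * a n \<le> (K' - 2 * v) * a n" using K' n(3) by (intro mult_right_mono) auto
      ultimately show "K * a n \<le> partial_sum X n \<omega> - b n" by (simp add: algebra_simps)
    qed measurable
    finally show "s / 4 \<le> prob {\<omega> \<in> space M. partial_sum X n \<omega> - b n \<ge> K * a n}" .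
  qed
  then show ?thesis using that[of "s / 4"] s by simp
qed

text \<open>The event that some remaining coordinate exceeds \<open>\<tau> * a n\<close> has probability of order
  \<open>\<tau> powr (- \<alpha>)\<close> under the product measure. For the vector without its maximum it requires two
  large coordinates, which has probability of order \<open>\<tau> powr (- 2 * \<alpha>)\<close>, even after conditioning
  on an event of probability bounded below.\<close>

lemma tv_dist_lim_imp_large:
  assumes lim: "(\<lambda>n. tv_dist
      (cond_law M {\<omega> \<in> space M. partial_sum X n \<omega> - b n \<ge> x n}
        (Pi\<^sub>M {..<n - 1} (\<lambda>_. borel)) (\<lambda>\<omega>. delete_max n (\<lambda>i. X i \<omega>)))
      (Pi\<^sub>M {..<n - 1} (\<lambda>_. D))) \<longlonglongrightarrow> 0"
  shows "filterlim (\<lambda>n. x n / a n) at_top sequentially"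
  unfolding filterlim_at_top
proof
  fix K :: real
  let ?E = "\<lambda>n. {\<omega> \<in> space M. partial_sum X n \<omega> - b n \<ge> x n}"
  let ?N = "\<lambda>n. Pi\<^sub>M {..<n - 1} (\<lambda>_. borel :: real measure)"
  let ?L = "\<lambda>n. cond_law M (?E n) (?N n) (\<lambda>\<omega>. delete_max n (\<lambda>i. X i \<omega>))"
  let ?Q = "\<lambda>n. Pi\<^sub>M {..<n - 1} (\<lambda>_. D)"
  obtain \<delta> where \<delta>: "\<delta> > 0"
    "eventually (\<lambda>n. prob {\<omega> \<in> space M. partial_sum X n \<omega> - b n \<ge> K * a n} \<ge> \<delta>) sequentially"
    by (rule prob_sum_bounded_below)
  \<comment> \<open>Chosen so that the linear term of \<open>g\<close> below beats both quadratic
    ones, including the one inflated by \<open>1 / \<delta>\<close> through conditioning.\<close>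
  obtain \<tau> where \<tau>: "\<tau> > 0" "p * \<tau> powr (- \<alpha>) < 1 / (1 + 1 / \<delta>)"
  proof -
    have "0 < 1 / (1 + 1 / \<delta>)" using \<delta>(1) by (simp add: add_pos_pos)
    from small_limit_at_a[OF this] show ?thesis using that by blast
  qed
  define s where "s = p * \<tau> powr (- \<alpha>)"
  have s: "s > 0" "s * (1 + 1 / \<delta>) < 1"
    using p \<tau> \<delta>(1) by (auto simp: s_def pos_less_divide_eq add_pos_pos)
  define g where "g = s - s\<^sup>2 - s\<^sup>2 / \<delta>"
  have "s * (s * (1 + 1 / \<delta>)) < s * 1" using s by (intro mult_strict_left_mono)
  then have g: "g > 0" by (simp add: g_def power2_eq_square algebra_simps)
  let ?W = "\<lambda>n. right_tail D (\<tau> * a n)"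
  have nW: "(\<lambda>n. real n * ?W n) \<longlonglongrightarrow> s" unfolding s_def by (rule right_tail_at_a[OF \<tau>(1)])
  have W0: "(\<lambda>n. ?W n) \<longlonglongrightarrow> 0"
    by (rule tendsto_sandwich[OF _ _ tendsto_const filterlim_compose[OF two_sided_tail_lim filterlim_compose[OF filterlim_scale[OF \<tau>(1)] a_lim]]])
      (auto simp: D.right_tail_nonneg D.right_tail_le_two_sided)
  \<comment> \<open>The product law has only \<open>n - 1\<close> coordinates; the difference is a
    single vanishing tail.\<close>
  have "(\<lambda>n. real (n - 1) * ?W n) \<longlonglongrightarrow> s"
  proof (rule Lim_transform_eventually)
    show "(\<lambda>n. real n * ?W n - ?W n) \<longlonglongrightarrow> s" using tendsto_diff[OF nW W0] by simp
    show "eventually (\<lambda>n. real n * ?W n - ?W n = real (n - 1) * ?W n) sequentially"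
      using eventually_ge_at_top[of 1] by eventually_elim (simp add: of_nat_diff algebra_simps)
  qed
  then have "(\<lambda>n. real (n - 1) * ?W n - (real (n - 1) * ?W n)\<^sup>2 - (real n * ?W n)\<^sup>2 / \<delta>) \<longlonglongrightarrow> g"
    unfolding g_def using \<delta>(1) by (intro tendsto_intros nW) auto
  then have "eventually (\<lambda>n. g / 2 < real (n - 1) * ?W n - (real (n - 1) * ?W n)\<^sup>2 - (real n * ?W n)\<^sup>2 / \<delta>) sequentially"
    by (rule order_tendstoD(1)) (use g in simp)
  moreover have "eventually (\<lambda>n. tv_dist (?L n) (?Q n) < g / 2) sequentially"
    by (rule order_tendstoD(2)[OF lim]) (use g in simp)
  ultimately show "eventually (\<lambda>n. K \<le> x n / a n) sequentially"
    using \<delta>(2) a_pos eventually_ge_at_top[of 2]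
  proof eventually_elim
    fix n assume n: "g / 2 < real (n - 1) * ?W n - (real (n - 1) * ?W n)\<^sup>2 - (real n * ?W n)\<^sup>2 / \<delta>"
      "tv_dist (?L n) (?Q n) < g / 2"
      "\<delta> \<le> prob {\<omega> \<in> space M. partial_sum X n \<omega> - b n \<ge> K * a n}" "0 < a n" "2 \<le> n"
    show "K \<le> x n / a n"
    \<comment> \<open>If \<open>x n < K * a n\<close>, the conditioning event has probability at
      least \<open>\<delta>\<close>, and the set \<open>?A\<close> separates the two laws by more
      than \<open>g / 2\<close>.\<close>
    proof (rule ccontr)
      assume "\<not> K \<le> x n / a n"
      then have "x n \<le> K * a n" using n(4) by (simp add: field_simps)
      then have "prob {\<omega> \<in> space M. partial_sum X n \<omega> - b n \<ge> K * a n} \<le> prob (?E n)"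
        by (intro finite_measure_mono) auto
      then have PE: "\<delta> \<le> prob (?E n)" using n(3) by simp
      then have PE0: "prob (?E n) > 0" using \<delta>(1) by simp
      let ?A = "{y \<in> space (?N n). \<exists>j<n - 1. y j \<ge> \<tau> * a n}"
      have "?A = (\<Union>j\<in>{..<n - 1}. {y \<in> space (?N n). y j \<ge> \<tau> * a n})" by auto
      also have "\<dots> \<in> sets (?N n)" by (intro sets.finite_UN) auto
      finally have A: "?A \<in> sets (?N n)" .
      have E: "?E n \<in> events" by measurable
      have "prob {\<omega> \<in> ?E n. delete_max n (\<lambda>i. X i \<omega>) \<in> ?A}
          \<le> prob {\<omega> \<in> space M. \<exists>j<n - 1. delete_max n (\<lambda>i. X i \<omega>) j \<ge> \<tau> * a n}"
      proof (rule finite_measure_mono)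
        have "{\<omega> \<in> space M. \<exists>j<n - 1. delete_max n (\<lambda>i. X i \<omega>) j \<ge> \<tau> * a n}
            = (\<lambda>\<omega>. delete_max n (\<lambda>i. X i \<omega>)) -` ?A \<inter> space M"
          using measurable_space[OF delete_max_measurable[of n]] by auto
        then show "{\<omega> \<in> space M. \<exists>j<n - 1. delete_max n (\<lambda>i. X i \<omega>) j \<ge> \<tau> * a n} \<in> events"
          using measurable_sets[OF delete_max_measurable A] by simp
      qed auto
      also have "\<dots> \<le> (real n * ?W n)\<^sup>2" by (rule prob_delete_max_large_le[OF n(5)])
      finally have "measure (?L n) ?A \<le> (real n * ?W n)\<^sup>2 / prob (?E n)"
        unfolding measure_cond_law[OF E delete_max_measurable A PE0] using PE0 by (intro divide_right_mono) auto
      also have "\<dots> \<le> (real n * ?W n)\<^sup>2 / \<delta>"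
        using PE \<delta>(1) by (intro divide_left_mono) auto
      finally have "measure (?L n) ?A \<le> (real n * ?W n)\<^sup>2 / \<delta>" .
      moreover have "real (n - 1) * ?W n - (real (n - 1) * ?W n)\<^sup>2 \<le> measure (?Q n) ?A"
        by (rule prob_exists_large_ge[OF n(5)])
      moreover have "\<bar>measure (?L n) ?A - measure (?Q n) ?A\<bar> \<le> tv_dist (?L n) (?Q n)"
        using A by (intro tv_dist_ge prob_space_cond_law[OF PE0 delete_max_measurable] prob_space_PiM_D) simp
      ultimately show False using n(1,2) by linarith
    qed
  qed
qed

end


section \<open>Tails of a law in the domain of attraction\<close>

text \<open>Removes the case distinction in \<open>tail_equiv\<close>: for eventually positive
  \<open>g\<close> both readings become a limit of ratios.\<close>

lemma tail_equiv_tendsto: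
  assumes "tail_equiv c f g" "eventually (\<lambda>t. g t > 0) at_top"
  shows "((\<lambda>t. f t / g t) \<longlongrightarrow> c) at_top"
proof (cases "c = 0")
  case True
  then show ?thesis using assms(1) by (simp add: tail_equiv_def smalloD_tendsto)
next
  case False
  then have "f \<sim>[at_top] (\<lambda>t. c * g t)" using assms(1) by (simp add: tail_equiv_def)
  then have "((\<lambda>t. f t / (c * g t)) \<longlongrightarrow> 1) at_top"
    by (rule asymp_equivD_strong) (use assms(2) False in \<open>auto elim!: eventually_mono\<close>)
  then have "((\<lambda>t. c * (f t / (c * g t))) \<longlongrightarrow> c * 1) at_top" by (intro tendsto_intros)
  then show ?thesis using False by simp
qed

lemma regularly_varying_scale:
  assumes L: "slowly_varying L" and c: "c > 0"
  shows "((\<lambda>t. L (c * t) * (c * t) powr (- \<alpha>) / (L t * t powr (- \<alpha>))) \<longlongrightarrow> c powr (- \<alpha>)) at_top"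
proof (rule Lim_transform_eventually)
  show "((\<lambda>t. L (c * t) / L t * c powr (- \<alpha>)) \<longlongrightarrow> c powr (- \<alpha>)) at_top"
  proof -
    have "((\<lambda>t. L (c * t) / L t) \<longlongrightarrow> 1) at_top" using L c by (simp add: slowly_varying_def)
    from tendsto_mult_right[OF this, of "c powr (- \<alpha>)"] show ?thesis by simp
  qed
  show "eventually (\<lambda>t. L (c * t) / L t * c powr (- \<alpha>) = L (c * t) * (c * t) powr (- \<alpha>) / (L t * t powr (- \<alpha>))) at_top"
    using eventually_gt_at_top[of 0] by eventually_elim (use c in \<open>simp add: powr_mult\<close>)
qed

lemma regularly_varying_pos:
  assumes L: "slowly_varying L"
  shows "eventually (\<lambda>t. L t * t powr (- \<alpha>) > 0) at_top"
proof -
  obtain A where "A > 0" "\<And>x. x \<ge> A \<Longrightarrow> L x > 0" using L unfolding slowly_varying_def by blast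
  then show ?thesis
    by (intro eventually_mono[OF eventually_ge_at_top[of A]]) (force intro!: mult_pos_pos)
qed

context real_distribution
begin

text \<open>Open and closed tails at \<open>t\<close> may differ by an atom. The closed tail lies
  between the open tails at \<open>t\<close> and at \<open>c * t\<close> for \<open>c < 1\<close>,
  and by regular variation the latter costs a factor \<open>c powr (- \<alpha>)\<close>, which tends
  to 1 with \<open>c\<close>.\<close>

lemma right_tail_equiv:
  assumes L: "slowly_varying L" and p: "p > 0"
    and R: "tail_equiv p (\<lambda>t. 1 - cdf M t) (\<lambda>t. L t * t powr (- \<alpha>))"
  shows "((\<lambda>t. right_tail M t / (L t * t powr (- \<alpha>))) \<longlongrightarrow> p) at_top"
proof -
  let ?G = "\<lambda>t. L t * t powr (- \<alpha>)"
  have R': "((\<lambda>t. (1 - cdf M t) / ?G t) \<longlongrightarrow> p) at_top"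
    by (rule tail_equiv_tendsto[OF R regularly_varying_pos[OF L]])
  have R_eq: "1 - cdf M t = measure M {t<..}" for t
  proof -
    have "measure M (space M - {..t}) = 1 - measure M {..t}" by (rule prob_compl) simp
    moreover have "space M - {..t} = {t<..}" by auto
    ultimately show ?thesis by (simp add: cdf_def)
  qed
  show ?thesis
  proof (rule order_tendstoI)
    fix y assume "y < p"
    from order_tendstoD(1)[OF R' this] show "eventually (\<lambda>t. y < right_tail M t / ?G t) at_top"
      using regularly_varying_pos[OF L, of \<alpha>]
    proof eventually_elim
      fix t assume t: "y < (1 - cdf M t) / ?G t" "0 < ?G t"
      have "1 - cdf M t \<le> right_tail M t"
        unfolding R_eq right_tail_def by (intro finite_measure_mono) auto
      then have "(1 - cdf M t) / ?G t \<le> right_tail M t / ?G t" using t(2) by (intro divide_right_mono) auto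
      then show "y < right_tail M t / ?G t" using t(1) by simp
    qed
  next
    fix y assume y: "p < y"
    have "((\<lambda>c. p * c powr (- \<alpha>)) \<longlongrightarrow> p * 1 powr (- \<alpha>)) (at_left 1)" by (intro tendsto_intros) auto
    then have "eventually (\<lambda>c. p * c powr (- \<alpha>) < y) (at_left 1)"
      by (rule order_tendstoD(2)) (use y in simp)
    moreover have "eventually (\<lambda>c::real. c \<in> {0<..<1}) (at_left 1)" by (rule eventually_at_left_real) simp
    ultimately have "eventually (\<lambda>c. 0 < c \<and> c < 1 \<and> p * c powr (- \<alpha>) < y) (at_left 1)"
      by eventually_elim auto
    then obtain c where c: "0 < c" "c < 1" "p * c powr (- \<alpha>) < y"
      using eventually_happens'[OF trivial_limit_at_left_real] by blast
    have sc: "filterlim (\<lambda>t. c * t) at_top at_top"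
      using c by (intro filterlim_scale)
    have "((\<lambda>t. (1 - cdf M (c * t)) / ?G (c * t) * (?G (c * t) / ?G t)) \<longlongrightarrow> p * c powr (- \<alpha>)) at_top"
      by (intro tendsto_mult filterlim_compose[OF R' sc] regularly_varying_scale L c)
    from order_tendstoD(2)[OF this c(3)] show "eventually (\<lambda>t. right_tail M t / ?G t < y) at_top"
      using regularly_varying_pos[OF L, of \<alpha>] eventually_compose_filterlim[OF regularly_varying_pos[OF L, of \<alpha>] sc]
        eventually_gt_at_top[of 0]
    proof eventually_elim
      fix t assume t: "(1 - cdf M (c * t)) / ?G (c * t) * (?G (c * t) / ?G t) < y"
        "0 < ?G t" "0 < ?G (c * t)" "0 < t"
      have "c * t < t" using c t(4) by simp
      then have "right_tail M t \<le> 1 - cdf M (c * t)"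
        unfolding R_eq right_tail_def by (intro finite_measure_mono) auto
      then have "right_tail M t / ?G t \<le> (1 - cdf M (c * t)) / ?G t" using t(2) by (intro divide_right_mono) auto
      also have "\<dots> = (1 - cdf M (c * t)) / ?G (c * t) * (?G (c * t) / ?G t)"
      proof -
        have "?G (c * t) \<noteq> 0" using t(3) by linarith
        then show ?thesis by simp
      qed
      finally show "right_tail M t / ?G t < y" using t(1) by simp
    qed
  qed
qed

lemma two_sided_tail_equiv:
  assumes L: "slowly_varying L" and p: "p > 0" "p + q = 1"
    and R: "tail_equiv p (\<lambda>t. 1 - cdf M t) (\<lambda>t. L t * t powr (- \<alpha>))"
    and l: "tail_equiv q (\<lambda>t. cdf M (- t)) (\<lambda>t. L t * t powr (- \<alpha>))"
  shows "((\<lambda>t. two_sided_tail M t / (L t * t powr (- \<alpha>))) \<longlongrightarrow> 1) at_top"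
proof (rule Lim_transform_eventually)
  let ?G = "\<lambda>t. L t * t powr (- \<alpha>)"
  show "((\<lambda>t. right_tail M t / ?G t + cdf M (- t) / ?G t) \<longlongrightarrow> 1) at_top"
    using tendsto_add[OF right_tail_equiv[OF L p(1) R] tail_equiv_tendsto[OF l regularly_varying_pos[OF L]]] p(2)
    by simp
  show "eventually (\<lambda>t. right_tail M t / ?G t + cdf M (- t) / ?G t = two_sided_tail M t / ?G t) at_top"
    using eventually_gt_at_top[of 0]
  proof eventually_elim
    fix t :: real assume "0 < t"
    then have "{y. t \<le> \<bar>y\<bar>} = {t..} \<union> {..- t}" "{t..} \<inter> {..- t} = {}" by (auto simp: abs_if)
    then have "two_sided_tail M t = right_tail M t + cdf M (- t)"
      unfolding two_sided_tail_def right_tail_def cdf_def by (simp add: finite_measure_Union)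
    then show "right_tail M t / ?G t + cdf M (- t) / ?G t = two_sided_tail M t / ?G t"
      by (simp add: add_divide_distrib)
  qed
qed

end

text \<open>Continuity points \<open>l\<close> and \<open>u\<close> are placed beyond the quantile
  bounds \<open>- k\<close> and \<open>k\<close> but inside modulus \<open>k + 1\<close>. A
  normalised sum of modulus at least \<open>k + 1\<close> is then at most \<open>l\<close> or above
  \<open>u\<close>, and convergence of distribution functions applies at both.\<close>

lemma (in iid_sequence) tight_if_weak_conv:
  assumes S: "real_distribution S"
    and conv: "weak_conv_m (\<lambda>n. distr M borel (\<lambda>\<omega>. (partial_sum X n \<omega> - b n) / a n)) S"
    and a_pos: "eventually (\<lambda>n. a n > 0) sequentially" and \<eta>: "\<eta> > 0"
  shows "\<exists>K>0. eventually (\<lambda>n. deviation n (b n) (K * a n) \<le> \<eta>) sequentially"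
proof -
  interpret S: real_distribution S by fact
  define F where "F n s = prob {\<omega> \<in> space M. (partial_sum X n \<omega> - b n) / a n \<le> s}" for n s
  have "cdf (distr M borel (\<lambda>\<omega>. (partial_sum X n \<omega> - b n) / a n)) s = F n s" for n s
    unfolding cdf_def F_def by (subst measure_distr) (auto intro!: arg_cong[where f=prob])
  then have F: "(\<lambda>n. F n s) \<longlonglongrightarrow> cdf S s" if "isCont (cdf S) s" for s
    using conv that unfolding weak_conv_m_def weak_conv_def by auto
  have "eventually (\<lambda>k. 1 - \<eta> / 2 < cdf S k) at_top"
    by (rule order_tendstoD(1)[OF S.cdf_lim_at_top_prob]) (use \<eta> in simp)
  moreover have "eventually (\<lambda>k. cdf S (- k) < \<eta> / 2) at_top"
    by (rule order_tendstoD(2)[OF filterlim_compose[OF S.cdf_lim_at_bot filterlim_uminus_at_bot_at_top]]) (use \<eta> in simp)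
  ultimately have "eventually (\<lambda>k. 0 < k \<and> 1 - \<eta> / 2 < cdf S k \<and> cdf S (- k) < \<eta> / 2) at_top"
    using eventually_gt_at_top[of 0] by eventually_elim auto
  then obtain k where k: "0 < k" "1 - \<eta> / 2 < cdf S k" "cdf S (- k) < \<eta> / 2"
    using eventually_happens'[OF trivial_limit_at_top_linorder] by blast
  obtain u where u: "k < u" "u < k + 1" "isCont (cdf S) u"
    using S.cdf_continuity_point_between[of k "k + 1"] by auto
  obtain l where l: "- (k + 1) < l" "l < - k" "isCont (cdf S) l"
    using S.cdf_continuity_point_between[of "- (k + 1)" "- k"] by auto
  have ul: "1 - \<eta> / 2 < cdf S u" "cdf S l < \<eta> / 2"
    using k u l S.cdf_nondecreasing[of k u] S.cdf_nondecreasing[of l "- k"] by auto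
  have "eventually (\<lambda>n. 1 - \<eta> / 2 < F n u) sequentially" "eventually (\<lambda>n. F n l < \<eta> / 2) sequentially"
    by (rule order_tendstoD(1)[OF F[OF u(3)] ul(1)], rule order_tendstoD(2)[OF F[OF l(3)] ul(2)])
  then have "eventually (\<lambda>n. deviation n (b n) ((k + 1) * a n) \<le> \<eta>) sequentially"
    using a_pos
  proof eventually_elim
    fix n assume n: "1 - \<eta> / 2 < F n u" "F n l < \<eta> / 2" "0 < a n"
    let ?Z = "\<lambda>\<omega>. (partial_sum X n \<omega> - b n) / a n"
    have "deviation n (b n) ((k + 1) * a n) \<le> prob ({\<omega> \<in> space M. ?Z \<omega> \<le> l} \<union> (space M - {\<omega> \<in> space M. ?Z \<omega> \<le> u}))"
      unfolding deviation_def
    proof (rule finite_measure_mono, safe)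
      fix \<omega> assume "(k + 1) * a n \<le> \<bar>partial_sum X n \<omega> - b n\<bar>" and Z: "?Z \<omega> \<le> u"
      then have "k + 1 \<le> \<bar>?Z \<omega>\<bar>" using n(3) by (simp add: abs_divide pos_le_divide_eq)
      then show "?Z \<omega> \<le> l" using Z u l by linarith
    qed measurable
    also have "\<dots> \<le> F n l + prob (space M - {\<omega> \<in> space M. ?Z \<omega> \<le> u})"
      unfolding F_def by (rule measure_Un_le) measurable
    also have "prob (space M - {\<omega> \<in> space M. ?Z \<omega> \<le> u}) = 1 - F n u"
      unfolding F_def by (rule prob_compl) measurable
    finally show "deviation n (b n) ((k + 1) * a n) \<le> \<eta>" using n by linarith
  qed
  then show ?thesis using k(1) by (intro exI[of _ "k + 1"]) auto
qed

text \<open>Right and two-sided tails are asymptotic to \<open>p * ?G\<close> and \<open>?G\<close>,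
  so \<open>?G\<close> cancels from every ratio in the locale.\<close>

lemma (in iid_sequence) heavy_tailed_sumsI:
  assumes \<alpha>: "0 < \<alpha>" "\<alpha> < 2" and p: "p > 0" "p + q = 1" and L: "slowly_varying L"
    and R: "tail_equiv p (\<lambda>t. 1 - cdf D t) (\<lambda>t. L t * t powr (- \<alpha>))"
    and l: "tail_equiv q (\<lambda>t. cdf D (- t)) (\<lambda>t. L t * t powr (- \<alpha>))"
    and a_pos: "eventually (\<lambda>n. a n > 0) sequentially" and a_lim: "filterlim a at_top sequentially"
    and a_norm: "(\<lambda>n. L (a n) * a n powr (- \<alpha>)) \<sim>[sequentially] (\<lambda>n. 1 / real n)"
    and S: "real_distribution S"
    and conv: "weak_conv_m (\<lambda>n. distr M borel (\<lambda>\<omega>. (partial_sum X n \<omega> - b n) / a n)) S"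
  shows "heavy_tailed_sums M X D \<alpha> p a b"
proof
  let ?G = "\<lambda>t. L t * t powr (- \<alpha>)"
  have pos: "eventually (\<lambda>t. ?G t > 0) at_top" by (rule regularly_varying_pos[OF L])
  have W: "((\<lambda>t. right_tail D t / ?G t) \<longlongrightarrow> p) at_top" by (rule D.right_tail_equiv[OF L p(1) R])
  have H: "((\<lambda>t. two_sided_tail D t / ?G t) \<longlongrightarrow> 1) at_top" by (rule D.two_sided_tail_equiv[OF L p R l])
  show tail_pos: "two_sided_tail D t > 0" for t
  proof -
    have "eventually (\<lambda>s. 0 < two_sided_tail D s / ?G s) at_top" by (rule order_tendstoD(1)[OF H]) simp
    then have "eventually (\<lambda>s. t \<le> s \<and> two_sided_tail D s > 0) at_top"
      using pos eventually_ge_at_top[of t] by eventually_elim (auto simp: zero_less_divide_iff)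
    then obtain s where "t \<le> s" "two_sided_tail D s > 0"
      using eventually_happens'[OF trivial_limit_at_top_linorder] by blast
    then show ?thesis using D.two_sided_tail_antimono[of t s] by simp
  qed
  show "((\<lambda>t. right_tail D t / two_sided_tail D t) \<longlongrightarrow> p) at_top"
  proof (rule Lim_transform_eventually)
    show "((\<lambda>t. (right_tail D t / ?G t) / (two_sided_tail D t / ?G t)) \<longlongrightarrow> p) at_top"
      using tendsto_divide[OF W H] by simp
    show "eventually (\<lambda>t. (right_tail D t / ?G t) / (two_sided_tail D t / ?G t) = right_tail D t / two_sided_tail D t) at_top"
      using pos
    proof eventually_elim
      fix t assume "0 < ?G t"
      then have "?G t \<noteq> 0" by linarith
      then show "(right_tail D t / ?G t) / (two_sided_tail D t / ?G t) = right_tail D t / two_sided_tail D t" by simp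
    qed
  qed
  show "((\<lambda>t. two_sided_tail D (c * t) / two_sided_tail D t) \<longlongrightarrow> c powr (- \<alpha>)) at_top" if c: "c > 0" for c
  proof (rule Lim_transform_eventually)
    have sc: "filterlim (\<lambda>t. c * t) at_top at_top"
      using c by (intro filterlim_scale)
    show "((\<lambda>t. (two_sided_tail D (c * t) / ?G (c * t)) * (?G (c * t) / ?G t) / (two_sided_tail D t / ?G t))
        \<longlongrightarrow> c powr (- \<alpha>)) at_top"
      using tendsto_divide[OF tendsto_mult[OF filterlim_compose[OF H sc] regularly_varying_scale[OF L c]] H]
      by simp
    show "eventually (\<lambda>t. (two_sided_tail D (c * t) / ?G (c * t)) * (?G (c * t) / ?G t) / (two_sided_tail D t / ?G t)
        = two_sided_tail D (c * t) / two_sided_tail D t) at_top"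
      using pos eventually_compose_filterlim[OF pos sc]
    proof eventually_elim
      fix t assume "0 < ?G t" "0 < ?G (c * t)"
      then have "?G t \<noteq> 0" "?G (c * t) \<noteq> 0" by linarith+
      then show "(two_sided_tail D (c * t) / ?G (c * t)) * (?G (c * t) / ?G t) / (two_sided_tail D t / ?G t)
        = two_sided_tail D (c * t) / two_sided_tail D t" by simp
    qed
  qed
  show "(\<lambda>n. real n * two_sided_tail D (a n)) \<longlonglongrightarrow> 1"
  proof (rule Lim_transform_eventually)
    have "(\<lambda>n. ?G (a n) / (1 / real n)) \<longlonglongrightarrow> 1"
      by (rule asymp_equivD_strong[OF a_norm]) (auto intro: eventually_mono[OF eventually_gt_at_top[of 0]])
    from tendsto_mult[OF this filterlim_compose[OF H a_lim]]
    show "(\<lambda>n. ?G (a n) / (1 / real n) * (two_sided_tail D (a n) / ?G (a n))) \<longlonglongrightarrow> 1" by simp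
    show "eventually (\<lambda>n. ?G (a n) / (1 / real n) * (two_sided_tail D (a n) / ?G (a n))
        = real n * two_sided_tail D (a n)) sequentially"
      using eventually_compose_filterlim[OF pos a_lim]
    proof eventually_elim
      fix n assume "0 < ?G (a n)"
      then have "?G (a n) \<noteq> 0" by linarith
      then show "?G (a n) / (1 / real n) * (two_sided_tail D (a n) / ?G (a n)) = real n * two_sided_tail D (a n)" by simp
    qed
  qed
  show "\<exists>K>0. eventually (\<lambda>n. deviation n (b n) (K * a n) \<le> \<eta>) sequentially" if "\<eta> > 0" for \<eta>
    by (rule tight_if_weak_conv[OF S conv a_pos that])
qed (use assms in auto)


theorem corollary3p2:
  fixes M :: "'a measure" and \<xi> :: "'a \<Rightarrow> real" and X :: "nat \<Rightarrow> 'a \<Rightarrow> real"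
    and \<alpha> p q :: real and L :: "real \<Rightarrow> real" and F :: "real \<Rightarrow> real"
    and a b x :: "nat \<Rightarrow> real" and S\<^sub>\<alpha> :: "real measure"
  assumes M: "prob_space M"
    and \<xi>: "\<xi> \<in> borel_measurable M"
    and indep: "prob_space.indep_vars M (\<lambda>_. borel) X UNIV"
    and copies: "\<And>i. distr M borel (X i) = distr M borel \<xi>"
    and \<alpha>: "0 < \<alpha>" "\<alpha> < 2"
    and pq: "p > 0" "q \<ge> 0" "p + q = 1"
    and L: "slowly_varying L"
    and F: "F = cdf (distr M borel \<xi>)"
    and right_tail: "tail_equiv p (\<lambda>t. 1 - F t) (\<lambda>t. L t * t powr (- \<alpha>))"
    and left_tail: "tail_equiv q (\<lambda>t. F (- t)) (\<lambda>t. L t * t powr (- \<alpha>))"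
    and a_pos: "\<And>n. n \<ge> 1 \<Longrightarrow> a n > 0"
    and a_lim: "filterlim a at_top sequentially"
    and a_norm: "(\<lambda>n. L (a n) * a n powr (- \<alpha>)) \<sim>[sequentially] (\<lambda>n. 1 / real n)"
    and b: "b = centering M \<xi> \<alpha> a"
    and stable: "alpha_stable \<alpha> S\<^sub>\<alpha>"
    and attraction:
      "weak_conv_m (\<lambda>n. distr M borel (\<lambda>\<omega>. (partial_sum X n \<omega> - b n) / a n)) S\<^sub>\<alpha>"
  shows
    "(filterlim (\<lambda>n. x n / a n) at_top sequentially \<longrightarrow>
       (\<lambda>n. \<P>(\<omega> in M. partial_sum X n \<omega> - b n \<ge> x n)) \<sim>[sequentially]
       (\<lambda>n. \<P>(\<omega> in M. partial_sum X n \<omega> - b n \<ge> x n \<and> partial_max X n \<omega> \<ge> x n)) \<and>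
       (\<lambda>n. \<P>(\<omega> in M. partial_sum X n \<omega> - b n \<ge> x n \<and> partial_max X n \<omega> \<ge> x n)) \<sim>[sequentially]
       (\<lambda>n. \<P>(\<omega> in M. partial_max X n \<omega> \<ge> x n)))
     \<and>
     (filterlim (\<lambda>n. x n / a n) at_top sequentially \<longleftrightarrow>
       (\<lambda>n. tv_dist
              (cond_law M {\<omega> \<in> space M. partial_sum X n \<omega> - b n \<ge> x n}
                 (Pi\<^sub>M {..<n - 1} (\<lambda>_. borel)) (\<lambda>\<omega>. delete_max n (\<lambda>i. X i \<omega>)))
              (Pi\<^sub>M {..<n - 1} (\<lambda>_. distr M borel \<xi>)))
       \<longlonglongrightarrow> 0)
     \<and>
     (filterlim (\<lambda>n. x n / a n) at_top sequentially \<longrightarrow>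
       weak_conv_m
         (\<lambda>n. cond_law M {\<omega> \<in> space M. partial_sum X n \<omega> - b n \<ge> x n} borel
                (\<lambda>\<omega>. (partial_sum X n \<omega> - b n - partial_max X n \<omega>) / a n))
         S\<^sub>\<alpha>)"
proof -
  interpret prob_space M by (rule M)
  let ?D = "distr M borel \<xi>"
  interpret iid_sequence M X ?D
    by standard (use indep copies in auto)
  have a_ev: "eventually (\<lambda>n. a n > 0) sequentially"
    using eventually_ge_at_top[of 1] by eventually_elim (rule a_pos)
  have S: "real_distribution S\<^sub>\<alpha>" using stable by (simp add: alpha_stable_def)
  interpret heavy_tailed_sums M X ?D \<alpha> p a b
    using right_tail left_tail unfolding F
    by (rule heavy_tailed_sumsI[OF \<alpha> pq(1,3) L _ _ a_ev a_lim a_norm S attraction])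
  \<comment> \<open>Kept as a conditional fact, since the growth of \<open>x n / a n\<close> is only
    a premise of the implications; the converse in (2) is proved in \<open>heavy_tailed_sums\<close>
    alone.\<close>
  have large: "large_deviation M X ?D \<alpha> p a b x" if "filterlim (\<lambda>n. x n / a n) at_top sequentially"
    by standard (rule that)
  note equiv = large_deviation.prob_sum_equiv[OF large] large_deviation.prob_both_equiv[OF large]
    large_deviation.prob_max_equiv[OF large]
  note equiv = equiv[THEN asymp_equivI']
  show ?thesis
    using asymp_equiv_trans[OF equiv(1) asymp_equiv_symI[OF equiv(2)]]
      asymp_equiv_trans[OF equiv(2) asymp_equiv_symI[OF equiv(3)]]
      large_deviation.tv_dist_rest_law_lim[OF large] tv_dist_lim_imp_large
      large_deviation.cond_law_without_max_weak_conv[OF large S attraction]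
    by blast
qed

end
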